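(* Let $X$ be a real convex-transitive Banach space satisfying the following two conditions: (a) the set of $\omega$-exposed points of $B_X$ is dense in $S_X$ with respect to the relative weak topology of $S_X$; (b) $\inf\{\operatorname{diam}(U) : U\subset S_X \text{ nonempty and relatively weakly open in } S_X\}<2$. Then $X\in\mathcal{J}$, i.e. $X$ is almost transitive, uniformly convex and uniformly smooth.
   Context: All spaces are real Banach spaces. $B_X$ is the closed unit ball and $S_X$ the unit sphere of $X$. $\mathcal{G}_X$ denotes the group of isometric automorphisms (surjective linear isometries) of $X$, and for $x\in S_X$ the orbit is $\mathcal{G}_X(x)=\{T(x): T\in\mathcal{G}_X\}$. $X$ is almost transitive if $\overline{\mathcal{G}_X(x)}=S_X$ for all $x\in S_X$, and convex-transitive if $\overline{\mathrm{conv}}(\mathcal{G}_X(x))=B_X$ for all $x\in S_X$. $\mathcal{J}$ denotes the class of Banach spaces that are simultaneously almost transitive, uniformly convex and uniformly smooth. A point $x\in S_X$ is $\omega$-exposed (weakly exposed) if there is $f\in S_{X^*}$ with $f(x)=1$ such that every sequence $(x_n)\subset B_X$ with $f(x_n)\to 1$ converges weakly to $x$. *)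

theory Defs
  imports "HOL-Analysis.Analysis"
begin

definition unit_sphere :: "'a::real_normed_vector set" where
  "unit_sphere = {x. norm x = 1}"

definition unit_ball :: "'a::real_normed_vector set" where
  "unit_ball = {x. norm x \<le> 1}"

definition isometric_automorphisms :: "('a::real_normed_vector \<Rightarrow> 'a) set" where
  "isometric_automorphisms = {T. linear T \<and> surj T \<and> (\<forall>x. norm (T x) = norm x)}"

definition orbit :: "'a::real_normed_vector \<Rightarrow> 'a set" where
  "orbit x = {T x | T. T \<in> isometric_automorphisms}"

definition almost_transitive :: "'a::real_normed_vector itself \<Rightarrow> bool" where
  "almost_transitive _ \<longleftrightarrow>
     (\<forall>x::'a. x \<in> unit_sphere \<longrightarrow> closure (orbit x) = unit_sphere)"

definition convex_transitive :: "'a::real_normed_vector itself \<Rightarrow> bool" where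
  "convex_transitive _ \<longleftrightarrow>
     (\<forall>x::'a. x \<in> unit_sphere \<longrightarrow> closure (convex hull (orbit x)) = unit_ball)"

definition uniformly_convex :: "'a::real_normed_vector itself \<Rightarrow> bool" where
  "uniformly_convex _ \<longleftrightarrow>
     (\<forall>\<epsilon>>0. \<exists>\<delta>>0. \<forall>x y::'a. norm x \<le> 1 \<longrightarrow> norm y \<le> 1 \<longrightarrow> norm (x - y) \<ge> \<epsilon>
         \<longrightarrow> norm ((x + y) /\<^sub>R 2) \<le> 1 - \<delta>)"

text \<open>Uniform smoothness: the modulus of smoothness
  rho(t) = sup {(norm (x + t y) + norm (x - t y))/2 - 1 : x, y in S_X} satisfies rho(t)/t -> 0 as t -> 0+.\<close>
definition uniformly_smooth :: "'a::real_normed_vector itself \<Rightarrow> bool" where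
  "uniformly_smooth _ \<longleftrightarrow>
     (\<forall>\<epsilon>>0. \<exists>\<delta>>0. \<forall>t. 0 < t \<and> t < \<delta> \<longrightarrow>
        (\<forall>x y::'a. norm x = 1 \<longrightarrow> norm y = 1 \<longrightarrow>
           (norm (x + t *\<^sub>R y) + norm (x - t *\<^sub>R y)) / 2 - 1 \<le> \<epsilon> * t))"

definition w_open_set :: "'a::real_normed_vector set \<Rightarrow> bool" where
  "w_open_set U \<longleftrightarrow>
     (\<forall>x\<in>U. \<exists>(F::('a \<Rightarrow> real) set) (\<epsilon>::real). finite F \<and> (\<forall>f\<in>F. bounded_linear f) \<and> \<epsilon> > 0 \<and>
        {y. \<forall>f\<in>F. \<bar>f y - f x\<bar> < \<epsilon>} \<subseteq> U)"

definition rel_weakly_open_sphere :: "'a::real_normed_vector set \<Rightarrow> bool" where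
  "rel_weakly_open_sphere U \<longleftrightarrow> (\<exists>W. w_open_set W \<and> U = unit_sphere \<inter> W)"

definition weakly_converges :: "(nat \<Rightarrow> 'a::real_normed_vector) \<Rightarrow> 'a \<Rightarrow> bool" where
  "weakly_converges s x \<longleftrightarrow> (\<forall>f::'a \<Rightarrow> real. bounded_linear f \<longrightarrow> (\<lambda>n. f (s n)) \<longlonglongrightarrow> f x)"

definition w_exposed :: "'a::real_normed_vector \<Rightarrow> bool" where
  "w_exposed x \<longleftrightarrow> norm x = 1 \<and>
     (\<exists>f::'a \<Rightarrow> real. bounded_linear f \<and> onorm f = 1 \<and> f x = 1 \<and>
        (\<forall>s. (\<forall>n. norm (s n) \<le> 1) \<longrightarrow> (\<lambda>n. f (s n)) \<longlonglongrightarrow> 1 \<longrightarrow> weakly_converges s x))"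

end

theory Submission
  imports Defs "HOL-Library.Ramsey"
begin

text \<open>By convex-transitivity, for every norm-one functional \<open>f\<close> and every unit vector \<open>x\<close> the orbit of
  \<open>x\<close> meets every slice of the unit ball defined by \<open>f\<close>. Hence any two points of the ball whose
  midpoint is nearly a unit vector can be moved together into a given slice, and a bound for the
  diameter of one slice bounds the distance of all such pairs. A weakly exposed point \<open>x\<close> of a
  weakly open set of diameter less than 2 has a slice inside this set, so \<open>X\<close> is uniformly
  non-square, and so is its dual. By a theorem of James both spaces are then reflexive, and a
  reflexive space has, for every \<open>\<epsilon>\<close>, a point at which the norm is smooth up to \<open>\<epsilon>\<close>. In \<open>X\<close> convexity of
  \<open>x \<mapsto> norm (x + t y) + norm (x - t y)\<close> spreads this smoothness from one orbit to the whole sphere,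
  and in the dual it yields slices of \<open>X\<close> of small diameter, hence uniform convexity. Finally, if
  \<open>f\<close> supports \<open>y\<close> and \<open>f (T x)\<close> is close to 1, uniform convexity forces \<open>T x\<close> close to \<open>y\<close>.\<close>

section \<open>The Hahn--Banach theorem\<close>

text \<open>Condition (b) only bounds one diameter by something below 2, so the slice argument alone
  cannot give more than non-squareness; arbitrarily small slices need another source. Reflexivity
  supplies it: for each \<epsilon> it yields one point at which the norm is nearly smooth, uniformly
  in the direction, and one point per \<epsilon> is enough because isometries spread the property.
  Convex-transitivity is a statement about \<open>X\<close>, and nothing similar is available for
  the dual. Therefore uniform convexity rests on a single functional \<open>f\<close> per \<epsilon>
  at which the dual norm is nearly smooth, and all moving is done in \<open>X\<close>: two points
  with a long midpoint are pushed together into a thin slice of \<open>f\<close>.\<close>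

definition sublinear :: "('a::real_vector \<Rightarrow> real) \<Rightarrow> bool" where
  "sublinear p \<longleftrightarrow> (\<forall>x y. p (x + y) \<le> p x + p y) \<and> (\<forall>x t. 0 \<le> t \<longrightarrow> p (t *\<^sub>R x) = t * p x)"

lemma sublinearI:
  assumes add: "\<And>x y. p (x + y) \<le> p x + p y"
    and scale: "\<And>t x. 0 < t \<Longrightarrow> p (t *\<^sub>R x) \<le> t * p x"
    and zero: "p 0 = 0"
  shows "sublinear p"
proof -
  have "p (t *\<^sub>R x) = t * p x" if "0 \<le> t" for t x
  proof (cases "t = 0")
    case False
    with that have t: "0 < t" by simp
    have "p (inverse t *\<^sub>R (t *\<^sub>R x)) \<le> inverse t * p (t *\<^sub>R x)"
      using t by (intro scale) simp
    then have "t * p x \<le> p (t *\<^sub>R x)"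
      using t by (simp add: field_simps)
    with scale[OF t, of x] show ?thesis by simp
  qed (simp add: zero)
  with add show ?thesis by (simp add: sublinear_def)
qed

lemma sublinear_add: "sublinear p \<Longrightarrow> p (x + y) \<le> p x + p y"
  by (simp add: sublinear_def)

lemma sublinear_scale: "sublinear p \<Longrightarrow> 0 \<le> t \<Longrightarrow> p (t *\<^sub>R x) = t * p x"
  by (simp add: sublinear_def)

lemma sublinear_zero: "sublinear p \<Longrightarrow> p 0 = 0"
  using sublinear_scale[of p 0 0] by simp

lemma sublinear_minus: "sublinear p \<Longrightarrow> - p (- x) \<le> p x"
  using sublinear_add[of p x "- x"] sublinear_zero[of p] by simp

lemma sublinear_norm: "sublinear (norm :: 'a::real_normed_vector \<Rightarrow> real)"
  by (simp add: sublinear_def norm_triangle_ineq)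

text \<open>\<open>q\<close> minimises \<open>p\<close> along the ray in direction \<open>a\<close>,
  tilted by the slope \<open>p a\<close>; it is the largest sublinear functional below
  \<open>p\<close> with \<open>q (- a) \<le> - p a\<close>. Hahn-Banach uses it twice: to fix the
  value at \<open>a\<close>, and to show that a minimal functional is odd.\<close>

lemma sublinear_decrease:
  assumes p: "sublinear p"
  obtains q where "sublinear q" "\<And>x. q x \<le> p x" "q (- a) \<le> - p a"
proof -
  define h where "h x t = p (x + t *\<^sub>R a) - t * p a" for x t
  define q where "q x = (INF t\<in>{0..}. h x t)" for x
  have below: "- p (- x) \<le> h x t" if "t \<in> {0..}" for x t
    using sublinear_add[OF p, of "x + t *\<^sub>R a" "- x"] sublinear_scale[OF p, of t a] that
    by (simp add: h_def)
  then have bdd: "bdd_below (h x ` {0..})" for x by (meson bdd_belowI2)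
  have q_le: "q x \<le> h x t" if "0 \<le> t" for x t
    unfolding q_def using bdd that by (intro cINF_lower) auto
  have q_ge: "c \<le> q x" if "\<And>t. 0 \<le> t \<Longrightarrow> c \<le> h x t" for c x
    unfolding q_def using that by (intro cINF_greatest) auto
  have q_p: "q x \<le> p x" for x
    using q_le[of 0 x] by (simp add: h_def)
  have "sublinear q"
  proof (rule sublinearI)
    fix x y
    have st: "q (x + y) \<le> h x s + h y t" if "0 \<le> s" "0 \<le> t" for s t
    proof -
      have "q (x + y) \<le> h (x + y) (s + t)" using that by (intro q_le) simp
      also have "\<dots> \<le> h x s + h y t"
        using sublinear_add[OF p, of "x + s *\<^sub>R a" "y + t *\<^sub>R a"]
        by (simp add: h_def algebra_simps)
      finally show ?thesis .
    qed
    have "q (x + y) - h x s \<le> q y" if "0 \<le> s" for s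
      using st[OF that] by (intro q_ge) (simp add: algebra_simps)
    then have "q (x + y) - q y \<le> q x"
      by (intro q_ge) (simp add: algebra_simps)
    then show "q (x + y) \<le> q x + q y" by simp
  next
    fix t :: real and x assume t: "0 < t"
    have "q (t *\<^sub>R x) / t \<le> q x"
    proof (rule q_ge)
      fix s :: real assume s: "0 \<le> s"
      have "q (t *\<^sub>R x) \<le> h (t *\<^sub>R x) (t * s)" using s t by (intro q_le) simp
      also have "\<dots> = t * h x s"
        using sublinear_scale[OF p, of t "x + s *\<^sub>R a"] t
        by (simp add: h_def algebra_simps)
      finally show "q (t *\<^sub>R x) / t \<le> h x s" using t by (simp add: field_simps)
    qed
    then show "q (t *\<^sub>R x) \<le> t * q x" using t by (simp add: field_simps)
  next
    have "0 \<le> q 0"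
      using below[of _ 0] sublinear_zero[OF p] by (intro q_ge) auto
    then show "q 0 = 0" using q_p[of 0] sublinear_zero[OF p] by simp
  qed
  moreover have "q (- a) \<le> - p a"
    using q_le[of 1 "- a"] sublinear_zero[OF p] by (simp add: h_def)
  ultimately show ?thesis using q_p that by blast
qed

text \<open>A pointwise infimum of sublinear functionals need not be subadditive; in a chain the
  smaller of \<open>q\<close> and \<open>r\<close> serves both summands. The common bound
  \<open>p\<close> keeps the infimum finite, since
  \<open>- p (- x) \<le> - q (- x) \<le> q x\<close>.\<close>

lemma sublinear_INF_chain:
  fixes p :: "'a::real_vector \<Rightarrow> real"
  assumes sub: "\<And>q. q \<in> C \<Longrightarrow> sublinear q \<and> q \<le> p"
    and chain: "\<And>q r. q \<in> C \<Longrightarrow> r \<in> C \<Longrightarrow> q \<le> r \<or> r \<le> q" and "C \<noteq> {}"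
  shows "sublinear (\<lambda>x. INF q\<in>C. q x) \<and> (\<forall>q\<in>C. (\<lambda>x. INF q\<in>C. q x) \<le> q)"
proof -
  define u where "u x = (INF q\<in>C. q x)" for x
  have "- p (- x) \<le> q x" if "q \<in> C" for q x
    using sub[OF that] sublinear_minus[of q x] by (simp add: le_fun_def) (smt (verit))
  then have bdd: "bdd_below ((\<lambda>q. q x) ` C)" for x by (meson bdd_belowI2)
  have u_le: "u x \<le> q x" if "q \<in> C" for x q
    unfolding u_def using bdd that by (intro cINF_lower) auto
  have u_ge: "c \<le> u x" if "\<And>q. q \<in> C \<Longrightarrow> c \<le> q x" for c x
    unfolding u_def using that \<open>C \<noteq> {}\<close> by (intro cINF_greatest) auto
  have "sublinear u"
  proof (rule sublinearI)
    fix x y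
    have st: "u (x + y) \<le> q x + r y" if qr: "q \<in> C" "r \<in> C" for q r
    proof -
      obtain s where s: "s \<in> C" "s \<le> q" "s \<le> r"
        using chain[OF qr] qr by blast
      have "u (x + y) \<le> s x + s y"
        using u_le[OF s(1), of "x + y"] sub[OF s(1)] sublinear_add[of s x y] by simp
      also have "\<dots> \<le> q x + r y" using s by (intro add_mono) (auto simp: le_fun_def)
      finally show ?thesis .
    qed
    have "u (x + y) - q x \<le> u y" if "q \<in> C" for q
      using st[OF that] by (intro u_ge) (simp add: algebra_simps)
    then have "u (x + y) - u y \<le> u x"
      by (intro u_ge) (simp add: algebra_simps)
    then show "u (x + y) \<le> u x + u y" by simp
  next
    fix t :: real and x assume t: "0 < t"
    have "u (t *\<^sub>R x) / t \<le> u x"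
    proof (rule u_ge)
      fix q assume q: "q \<in> C"
      have "u (t *\<^sub>R x) \<le> t * q x"
        using u_le[OF q, of "t *\<^sub>R x"] sub[OF q] sublinear_scale[of q t x] t by simp
      then show "u (t *\<^sub>R x) / t \<le> q x" using t by (simp add: field_simps)
    qed
    then show "u (t *\<^sub>R x) \<le> t * u x" using t by (simp add: field_simps)
  next
    have "q 0 = 0" if "q \<in> C" for q using sub[OF that] sublinear_zero by blast
    then show "u 0 = 0" using u_ge[of 0 0] u_le[of _ 0] \<open>C \<noteq> {}\<close> by fastforce
  qed
  then show ?thesis using u_le by (auto simp: u_def[abs_def] le_fun_def)
qed

text \<open>A minimal sublinear functional is linear, because otherwise \<open>sublinear_decrease\<close> would
  make it smaller.\<close>

theorem hahn_banach:
  fixes p :: "'a::real_vector \<Rightarrow> real"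
  assumes p: "sublinear p"
  obtains F where "linear F" "\<And>x. F x \<le> p x" "F a = p a"
proof -
  \<comment> \<open>Every linear functional below \<open>p'\<close> has
    \<open>F (- a) \<le> - p a\<close>, hence \<open>F a \<ge> p a\<close>: lowering
    \<open>p\<close> once, before Zorn's lemma, takes care of the value at \<open>a\<close>. The
    relation given to Zorn is reversed, so its maximal elements are minimal functionals.\<close>
  obtain p' where p': "sublinear p'" "\<And>x. p' x \<le> p x" "p' (- a) \<le> - p a"
    using sublinear_decrease[OF p] by blast
  define A where "A = {q. sublinear q \<and> q \<le> p'}"
  have "\<exists>m\<in>A. \<forall>q\<in>A. q \<le> m \<longrightarrow> q = m"
  proof (rule predicate_Zorn)
    show "partial_order_on A (relation_of (\<lambda>q r. r \<le> q) A)"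
      by (rule partial_order_on_relation_ofI) auto
  next
    fix C assume C: "C \<in> Chains (relation_of (\<lambda>q r. r \<le> q) A)"
    then have CA: "C \<subseteq> A" by (auto simp: Chains_def relation_of_def)
    show "\<exists>u\<in>A. \<forall>q\<in>C. u \<le> q"
    proof (cases "C = {}")
      case True
      then show ?thesis using p'(1) by (auto simp: A_def)
    next
      case False
      have ch: "\<And>q r. q \<in> C \<Longrightarrow> r \<in> C \<Longrightarrow> q \<le> r \<or> r \<le> q"
        using C by (auto simp: Chains_def relation_of_def)
      have sub: "\<And>q. q \<in> C \<Longrightarrow> sublinear q \<and> q \<le> p'" using CA by (auto simp: A_def)
      define u where "u = (\<lambda>x. INF q\<in>C. q x)"
      have "sublinear u" "\<forall>q\<in>C. u \<le> q"
        using sublinear_INF_chain[of C p', OF sub ch False] by (auto simp: u_def)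
      moreover from this have "u \<le> p'" using sub False by (meson ex_in_conv order_trans)
      ultimately show ?thesis by (auto simp: A_def)
    qed
  qed
  then obtain F where F: "sublinear F" "F \<le> p'" and min: "\<And>q. sublinear q \<Longrightarrow> q \<le> F \<Longrightarrow> q = F"
    unfolding A_def by (auto intro: order_trans)
  have odd: "F (- x) = - F x" for x
  proof -
    obtain q where q: "sublinear q" "\<And>y. q y \<le> F y" "q (- x) \<le> - F x"
      using sublinear_decrease[OF F(1)] by blast
    then have "q = F" by (intro min) (auto simp: le_fun_def)
    with q(3) sublinear_minus[OF F(1), of x] show ?thesis by simp
  qed
  have "linear F"
  proof (rule linearI)
    fix x y
    have "F (- x + - y) \<le> F (- x) + F (- y)" by (rule sublinear_add[OF F(1)])
    then have "F x + F y \<le> F (x + y)" using odd[of "x + y"] by (simp add: odd)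
    then show "F (x + y) = F x + F y" using sublinear_add[OF F(1), of x y] by simp
  next
    fix t x
    show "F (t *\<^sub>R x) = t *\<^sub>R F x"
    proof (cases "0 \<le> t")
      case False
      then have "F ((- t) *\<^sub>R x) = - t * F x" by (intro sublinear_scale[OF F(1)]) simp
      then show ?thesis using odd[of "t *\<^sub>R x"] by simp
    qed (simp add: sublinear_scale[OF F(1)])
  qed
  moreover have le: "F x \<le> p x" for x using F(2) p'(2)[of x] by (auto simp: le_fun_def intro: order_trans)
  moreover have "F a = p a"
    using le[of a] odd[of a] p'(3) F(2) by (simp add: le_fun_def) (smt (verit))
  ultimately show ?thesis using that by blast
qed

lemma hahn_banach_blinfun:
  fixes p :: "'a::real_normed_vector \<Rightarrow> real"
  assumes "sublinear p" and C: "\<And>x. p x \<le> C * norm x" "0 \<le> C"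
  obtains F :: "'a \<Rightarrow>\<^sub>L real" where "\<And>x. F x \<le> p x" "F a = p a" "norm F \<le> C"
proof -
  obtain F where F: "linear F" "\<And>x. F x \<le> p x" "F a = p a"
    using hahn_banach[OF assms(1)] by blast
  have bnd: "\<bar>F x\<bar> \<le> C * norm x" for x
    using F(2)[of x] F(2)[of "- x"] C(1)[of x] C(1)[of "- x"] linear_neg[OF F(1), of x] by simp
  have "bounded_linear F"
    using F(1) bnd by (auto simp: bounded_linear_def bounded_linear_axioms_def mult.commute)
  then have ap: "blinfun_apply (Blinfun F) = F" by (simp add: bounded_linear_Blinfun_apply)
  have "norm (Blinfun F) \<le> C" using bnd C(2) by (intro norm_blinfun_bound) (auto simp: ap)
  then show ?thesis using F that[of "Blinfun F"] by (simp add: ap)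
qed

lemma blinfun_le_norm:
  fixes f :: "'a::real_normed_vector \<Rightarrow>\<^sub>L real"
  shows "\<bar>f x\<bar> \<le> norm f * norm x" "f x \<le> norm f * norm x"
  using norm_blinfun[of f x] by auto

lemma blinfun_le_norm1:
  fixes f :: "'a::real_normed_vector \<Rightarrow>\<^sub>L real"
  assumes "norm f \<le> 1"
  shows "f x \<le> norm x" "- f x \<le> norm x"
  using blinfun_le_norm(1)[of f x] mult_right_mono[OF assms norm_ge_zero[of x]] by auto

lemma norming_functional:
  fixes a :: "'a::real_normed_vector"
  obtains f :: "'a \<Rightarrow>\<^sub>L real" where "f a = norm a" "norm f \<le> 1"
  using hahn_banach_blinfun[OF sublinear_norm, of 1 a] by auto

lemma norming_functional_unit:
  fixes a :: "'a::real_normed_vector"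
  assumes "a \<noteq> 0"
  obtains f :: "'a \<Rightarrow>\<^sub>L real" where "f a = norm a" "norm f = 1"
proof -
  obtain f :: "'a \<Rightarrow>\<^sub>L real" where f: "f a = norm a" "norm f \<le> 1" by (rule norming_functional)
  have "norm a \<le> norm f * norm a" using blinfun_le_norm(2)[of f a] f(1) by simp
  then have "1 \<le> norm f" using assms by simp
  with f that show ?thesis by (meson antisym)
qed

text \<open>The infimal convolution of \<open>C * norm\<close> with the restriction of
  \<open>F\<close> to \<open>N\<close>. A linear functional below it is bounded by \<open>C\<close>
  and, as \<open>N\<close> is symmetric, agrees with \<open>F\<close> on \<open>N\<close>; this
  gives extensions. For zero \<open>F\<close> and \<open>C = 1\<close> it is the distance to
  \<open>N\<close>, which gives functionals vanishing on \<open>N\<close>.\<close>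

lemma sublinear_inf_convolution:
  fixes F :: "'a::real_normed_vector \<Rightarrow> real"
  assumes N: "subspace N" and F: "linear F" and C: "0 \<le> C" and le: "\<And>g. g \<in> N \<Longrightarrow> F g \<le> C * norm g"
  defines "p \<equiv> \<lambda>x. INF g\<in>N. C * norm (x - g) + F g"
  shows "sublinear p" "\<And>x. p x \<le> C * norm x" "\<And>g. g \<in> N \<Longrightarrow> p g \<le> F g"
proof -
  have N0: "0 \<in> N" by (rule subspace_0[OF N])
  have below: "- (C * norm x) \<le> C * norm (x - g) + F g" if "g \<in> N" for x g
  proof -
    have "- F g \<le> C * norm g"
      using le[of "- g"] subspace_neg[OF N that] linear_neg[OF F, of g] by simp
    moreover have "C * norm g \<le> C * (norm (x - g) + norm x)"
      by (intro mult_left_mono C) (metis norm_minus_commute norm_triangle_sub add.commute)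
    ultimately show ?thesis by (simp add: algebra_simps)
  qed
  then have bdd: "bdd_below ((\<lambda>g. C * norm (x - g) + F g) ` N)" for x by (meson bdd_belowI2)
  have p_le: "p x \<le> C * norm (x - g) + F g" if "g \<in> N" for x g
    unfolding p_def using bdd that by (intro cINF_lower) auto
  have p_ge: "c \<le> p x" if "\<And>g. g \<in> N \<Longrightarrow> c \<le> C * norm (x - g) + F g" for c x
    unfolding p_def using that N0 by (intro cINF_greatest) auto
  show pC: "p x \<le> C * norm x" for x
    using p_le[OF N0, of x] linear_0[OF F] by simp
  show "p g \<le> F g" if "g \<in> N" for g
    using p_le[OF that, of g] by simp
  show "sublinear p"
  proof (rule sublinearI)
    fix x y
    have st: "p (x + y) \<le> (C * norm (x - g) + F g) + (C * norm (y - h) + F h)" if "g \<in> N" "h \<in> N" for g h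
    proof -
      have "p (x + y) \<le> C * norm ((x - g) + (y - h)) + (F g + F h)"
        using p_le[OF subspace_add[OF N that], of "x + y"] by (simp add: linear_add[OF F] algebra_simps)
      also have "C * norm ((x - g) + (y - h)) \<le> C * (norm (x - g) + norm (y - h))"
        by (intro mult_left_mono C norm_triangle_ineq)
      finally show ?thesis by (simp add: algebra_simps)
    qed
    have "p (x + y) - (C * norm (x - g) + F g) \<le> p y" if "g \<in> N" for g
      using st[OF that] by (intro p_ge) (simp add: algebra_simps)
    then have "p (x + y) - p y \<le> p x"
      by (intro p_ge) (simp add: algebra_simps)
    then show "p (x + y) \<le> p x + p y" by simp
  next
    fix t :: real and x assume t: "0 < t"
    have "p (t *\<^sub>R x) / t \<le> p x"
    proof (rule p_ge)
      fix g assume g: "g \<in> N"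
      have "p (t *\<^sub>R x) \<le> C * norm (t *\<^sub>R x - t *\<^sub>R g) + F (t *\<^sub>R g)"
        using subspace_scale[OF N g] by (rule p_le)
      also have "\<dots> = t * (C * norm (x - g) + F g)"
        using t by (simp add: linear_scale[OF F] flip: scaleR_diff_right) (simp add: algebra_simps)
      finally show "p (t *\<^sub>R x) / t \<le> C * norm (x - g) + F g" using t by (simp add: field_simps)
    qed
    then show "p (t *\<^sub>R x) \<le> t * p x" using t by (simp add: field_simps)
  next
    show "p 0 = 0" using p_ge[of 0 0] below[of _ 0] pC[of 0] by force
  qed
qed

lemma functional_extension:
  fixes F :: "'a::real_normed_vector \<Rightarrow> real"
  assumes "subspace N" "linear F" "0 \<le> C" "\<And>g. g \<in> N \<Longrightarrow> F g \<le> C * norm g"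
  obtains G :: "'a \<Rightarrow>\<^sub>L real" where "\<And>g. g \<in> N \<Longrightarrow> G g = F g" "norm G \<le> C"
proof -
  note p = sublinear_inf_convolution[OF assms]
  obtain G :: "'a \<Rightarrow>\<^sub>L real" where G: "\<And>x. G x \<le> (INF g\<in>N. C * norm (x - g) + F g)" "norm G \<le> C"
    using hahn_banach_blinfun[OF p(1,2) assms(3)] by blast
  have le: "G g \<le> F g" if "g \<in> N" for g using G(1)[of g] p(3)[OF _ that] by simp
  have "G g = F g" if "g \<in> N" for g
    using le[OF that] le[OF subspace_neg[OF assms(1) that]] linear_neg[OF assms(2), of g]
    by (simp add: blinfun.minus_right)
  with G(2) that show ?thesis by blast
qed

lemma distance_functional:
  fixes a :: "'a::real_normed_vector"
  assumes N: "subspace N"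
  obtains G :: "'a \<Rightarrow>\<^sub>L real" where "\<And>n. n \<in> N \<Longrightarrow> G n = 0" "norm G \<le> 1" "G a = infdist a N"
proof -
  have "linear (\<lambda>_::'a. 0::real)" by (simp add: linear_iff)
  note p = sublinear_inf_convolution[of N "\<lambda>_. 0" 1, OF N this]
  have eq: "(INF g\<in>N. 1 * norm (x - g) + 0) = infdist x N" for x
    using subspace_0[OF N] by (auto simp: infdist_def dist_norm)
  obtain G :: "'a \<Rightarrow>\<^sub>L real" where G: "\<And>x. G x \<le> infdist x N" "G a = infdist a N" "norm G \<le> 1"
    using hahn_banach_blinfun[OF p(1,2), where a = a] unfolding eq by auto
  have "G n = 0" if "n \<in> N" for n
    using G(1)[of n] G(1)[of "- n"] that subspace_neg[OF N that]
    by (simp add: blinfun.minus_right)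
  with G that show ?thesis by blast
qed

section \<open>Finite interpolation in the bidual\<close>

text \<open>Stated for an abstract vector space because it serves both on \<open>X\<close> with
  functionals and on the dual with evaluations at points. If \<open>\<Phi> j\<close> does not vanish
  on the common kernel of the others, a vector \<open>e\<close> seen by \<open>\<Phi> j\<close>
  alone allows subtracting \<open>\<psi> e * \<Phi> j\<close> from \<open>\<psi>\<close>, which
  reduces the claim to \<open>I\<close>.\<close>

lemma linear_functional_combination:
  fixes \<Phi> :: "'i \<Rightarrow> 'b::real_vector \<Rightarrow> real"
  assumes "finite I" "\<And>i. i \<in> I \<Longrightarrow> linear (\<Phi> i)" "linear \<psi>"
    and "\<And>x. (\<And>i. i \<in> I \<Longrightarrow> \<Phi> i x = 0) \<Longrightarrow> \<psi> x = 0"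
  shows "\<exists>c. \<forall>x. \<psi> x = (\<Sum>i\<in>I. c i * \<Phi> i x)"
  using assms
proof (induction I arbitrary: \<psi> rule: finite_induct)
  case empty
  then show ?case by simp
next
  case (insert j I)
  have lin: "linear (\<Phi> j)" "\<And>i. i \<in> I \<Longrightarrow> linear (\<Phi> i)" using insert.prems(1) by auto
  show ?case
  proof (cases "\<forall>x. (\<forall>i\<in>I. \<Phi> i x = 0) \<longrightarrow> \<Phi> j x = 0")
    case True
    have "\<exists>c. \<forall>x. \<psi> x = (\<Sum>i\<in>I. c i * \<Phi> i x)"
    proof (rule insert.IH[OF lin(2) insert.prems(2)])
      fix x assume "\<And>i. i \<in> I \<Longrightarrow> \<Phi> i x = 0"
      with True show "\<psi> x = 0" by (intro insert.prems(3)) blast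
    qed
    then obtain c where c: "\<psi> x = (\<Sum>i\<in>I. c i * \<Phi> i x)" for x by auto
    have "\<psi> x = (\<Sum>i\<in>insert j I. (c(j := 0)) i * \<Phi> i x)" for x
    proof -
      have "(\<Sum>i\<in>I. (c(j := 0)) i * \<Phi> i x) = (\<Sum>i\<in>I. c i * \<Phi> i x)"
        using insert.hyps by (intro sum.cong) auto
      then show ?thesis using insert.hyps c[of x] by simp
    qed
    then show ?thesis by (intro exI allI)
  next
    case False
    then obtain e0 where e0: "\<forall>i\<in>I. \<Phi> i e0 = 0" "\<Phi> j e0 \<noteq> 0" by blast
    define e where "e = inverse (\<Phi> j e0) *\<^sub>R e0"
    have e: "\<Phi> i e = 0" if "i \<in> I" for i
      using e0 that linear_scale[OF lin(2)[OF that]] by (simp add: e_def)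
    have ej: "\<Phi> j e = 1" using e0 linear_scale[OF lin(1)] by (simp add: e_def)
    define \<psi>' where "\<psi>' x = \<psi> x - \<psi> e * \<Phi> j x" for x
    have lin': "linear \<psi>'"
      unfolding \<psi>'_def[abs_def]
      by (intro linearI) (simp_all add: linear_add[OF insert.prems(2)] linear_add[OF lin(1)]
          linear_scale[OF insert.prems(2)] linear_scale[OF lin(1)] algebra_simps)
    have zero': "\<psi>' x = 0" if x: "\<And>i. i \<in> I \<Longrightarrow> \<Phi> i x = 0" for x
    proof -
      have "\<psi> (x - \<Phi> j x *\<^sub>R e) = 0"
      proof (rule insert.prems(3))
        fix i assume i: "i \<in> insert j I"
        then have "linear (\<Phi> i)" using insert.prems(1) by blast
        then have "\<Phi> i (x - \<Phi> j x *\<^sub>R e) = \<Phi> i x - \<Phi> j x * \<Phi> i e"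
          by (simp add: linear_diff linear_scale)
        moreover have "\<Phi> i x - \<Phi> j x * \<Phi> i e = 0"
          using i x[of i] e[of i] ej by (cases "i = j") simp_all
        ultimately show "\<Phi> i (x - \<Phi> j x *\<^sub>R e) = 0" by simp
      qed
      then show ?thesis
        by (simp add: \<psi>'_def linear_diff[OF insert.prems(2)] linear_scale[OF insert.prems(2)])
    qed
    have "\<exists>c. \<forall>x. \<psi>' x = (\<Sum>i\<in>I. c i * \<Phi> i x)"
      by (rule insert.IH[OF lin(2) lin' zero'])
    then obtain c where c': "\<forall>x. \<psi>' x = (\<Sum>i\<in>I. c i * \<Phi> i x)" ..
    have c: "\<psi> x = \<psi> e * \<Phi> j x + (\<Sum>i\<in>I. c i * \<Phi> i x)" for x
      using spec[OF c', of x] unfolding \<psi>'_def by linarith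
    have "\<psi> x = (\<Sum>i\<in>insert j I. (c(j := \<psi> e)) i * \<Phi> i x)" for x
    proof -
      have "(\<Sum>i\<in>I. (c(j := \<psi> e)) i * \<Phi> i x) = (\<Sum>i\<in>I. c i * \<Phi> i x)"
        using insert.hyps by (intro sum.cong) auto
      then show ?thesis using insert.hyps c[of x] by simp
    qed
    then show ?thesis by (intro exI allI)
  qed
qed

lemma linear_blinfun_apply: "linear (blinfun_apply f)"
  using blinfun.bounded_linear_right bounded_linear.linear by blast

lemma linear_blinfun_eval: "linear (\<lambda>f :: 'a::real_normed_vector \<Rightarrow>\<^sub>L real. f x)"
  using blinfun.bounded_linear_left bounded_linear.linear by blast

lemma functional_combination_in_dual:
  fixes fs :: "'i \<Rightarrow> 'a::real_normed_vector \<Rightarrow>\<^sub>L real" and g :: "'a \<Rightarrow>\<^sub>L real"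
  assumes "finite I" "\<And>x. (\<And>i. i \<in> I \<Longrightarrow> fs i x = 0) \<Longrightarrow> g x = 0"
  obtains c where "g = (\<Sum>i\<in>I. c i *\<^sub>R fs i)"
proof -
  have "\<exists>c. \<forall>x. g x = (\<Sum>i\<in>I. c i * fs i x)"
    using assms linear_blinfun_apply by (intro linear_functional_combination) auto
  then obtain c where c: "\<forall>x. g x = (\<Sum>i\<in>I. c i * fs i x)" ..
  have "g = (\<Sum>i\<in>I. c i *\<^sub>R fs i)"
    by (intro blinfun_eqI) (simp add: c blinfun.sum_left blinfun.scaleR_left)
  with that show ?thesis by blast
qed

text \<open>The algebraic part of Helly's theorem: a dependent functional takes the right value by
  linearity of \<open>F\<close>, an independent one is corrected along a vector killed by the
  others.\<close>

lemma bidual_finite_interpolation: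
  fixes F :: "('a::real_normed_vector \<Rightarrow>\<^sub>L real) \<Rightarrow>\<^sub>L real"
    and fs :: "'i \<Rightarrow> 'a \<Rightarrow>\<^sub>L real"
  assumes "finite I"
  shows "\<exists>x. \<forall>i\<in>I. fs i x = F (fs i)"
  using assms
proof (induction I rule: finite_induct)
  case (insert j I)
  then obtain x where x: "\<forall>i\<in>I. fs i x = F (fs i)" by blast
  show ?case
  proof (cases "\<forall>y. (\<forall>i\<in>I. fs i y = 0) \<longrightarrow> fs j y = 0")
    case True
    then obtain c where c: "fs j = (\<Sum>i\<in>I. c i *\<^sub>R fs i)"
      using functional_combination_in_dual[of I fs "fs j"] insert.hyps by blast
    have "fs j x = F (fs j)"
      unfolding c using x
      by (simp add: blinfun.sum_left blinfun.scaleR_left blinfun.sum_right blinfun.scaleR_right)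
    with x show ?thesis by auto
  next
    case False
    then obtain e where e: "\<forall>i\<in>I. fs i e = 0" "fs j e \<noteq> 0" by blast
    define y where "y = x + ((F (fs j) - fs j x) / fs j e) *\<^sub>R e"
    have "\<forall>i\<in>insert j I. fs i y = F (fs i)"
      using x e by (auto simp: y_def blinfun.add_right blinfun.scaleR_right)
    then show ?thesis by blast
  qed
qed simp

text \<open>The distance from an algebraic solution \<open>x\<close> to the common kernel
  \<open>E\<close> is the value at \<open>x\<close> of a functional \<open>G\<close> of norm at most
  1 vanishing on \<open>E\<close>. Such a \<open>G\<close> is a combination of the
  \<open>fs i\<close>, so \<open>G x = F G \<le> norm F\<close>. The distance need not be attained;
  the slack \<open>+ 1\<close> absorbs this.\<close>

lemma helly_interpolation:
  fixes F :: "('a::real_normed_vector \<Rightarrow>\<^sub>L real) \<Rightarrow>\<^sub>L real"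
    and fs :: "'i \<Rightarrow> 'a \<Rightarrow>\<^sub>L real"
  assumes I: "finite I"
  shows "\<exists>x. norm x \<le> norm F + 1 \<and> (\<forall>i\<in>I. fs i x = F (fs i))"
proof -
  obtain x where x: "\<forall>i\<in>I. fs i x = F (fs i)"
    using bidual_finite_interpolation[OF I] by blast
  define E where "E = {y. \<forall>i\<in>I. fs i y = 0}"
  have E: "subspace E"
    by (auto simp: subspace_def E_def blinfun.add_right blinfun.scaleR_right)
  obtain G :: "'a \<Rightarrow>\<^sub>L real" where G: "\<And>n. n \<in> E \<Longrightarrow> G n = 0" "norm G \<le> 1" "G x = infdist x E"
    using distance_functional[OF E] by blast
  obtain c where c: "G = (\<Sum>i\<in>I. c i *\<^sub>R fs i)"
    using functional_combination_in_dual[OF I, of fs G] G(1) by (auto simp: E_def)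
  have "G x = F G"
    unfolding c using x
    by (simp add: blinfun.sum_left blinfun.scaleR_left blinfun.sum_right blinfun.scaleR_right)
  also have "\<dots> \<le> norm F * norm G" by (rule blinfun_le_norm)
  also have "\<dots> \<le> norm F" using mult_left_mono[OF G(2) norm_ge_zero[of F]] by simp
  finally have "infdist x E < norm F + 1" using G(3) by simp
  moreover have "E \<noteq> {}" using subspace_0[OF E] by blast
  ultimately obtain e where e: "e \<in> E" "dist x e < norm F + 1"
    using cInf_lessD[of "dist x ` E" "norm F + 1"] by (auto simp: infdist_def)
  have "\<forall>i\<in>I. fs i (x - e) = F (fs i)"
    using x e(1) by (auto simp: E_def blinfun.diff_right)
  moreover have "norm (x - e) \<le> norm F + 1" using e(2) by (simp add: dist_norm)
  ultimately show ?thesis by blast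
qed

text \<open>Here \<open>blinfun.prod_left y\<close> is evaluation at \<open>y\<close>. If
  \<open>F\<close> had norm at most \<open>t\<close> on the annihilator of the points
  \<open>x i\<close>, an extension of this restriction with norm at most \<open>t\<close> would
  differ from \<open>F\<close> by evaluation at a combination of the \<open>x i\<close>, and that
  point would be closer to \<open>F\<close> than \<open>d\<close>.\<close>

lemma bidual_annihilator:
  fixes F :: "('a::real_normed_vector \<Rightarrow>\<^sub>L real) \<Rightarrow>\<^sub>L real"
  assumes I: "finite I" and d: "\<And>y. d \<le> norm (F - blinfun.prod_left y)" and t: "0 < t" "t < d"
  shows "\<exists>f. norm f \<le> 1 \<and> F f = t \<and> (\<forall>i\<in>I. f (x i) = 0)"
proof -
  define N where "N = {f :: 'a \<Rightarrow>\<^sub>L real. \<forall>i\<in>I. f (x i) = 0}"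
  have N: "subspace N"
    by (auto simp: subspace_def N_def blinfun.add_left blinfun.scaleR_left)
  have "\<exists>f\<in>N. t * norm f < F f"
  proof (rule ccontr)
    assume "\<not> ?thesis"
    then have le: "F f \<le> t * norm f" if "f \<in> N" for f using that by force
    obtain G :: "('a \<Rightarrow>\<^sub>L real) \<Rightarrow>\<^sub>L real" where G: "\<And>g. g \<in> N \<Longrightarrow> G g = F g" "norm G \<le> t"
      using functional_extension[OF N linear_blinfun_apply less_imp_le[OF t(1)] le] by blast
    have "(F - G) f = 0" if "\<And>i. i \<in> I \<Longrightarrow> f (x i) = 0" for f :: "'a \<Rightarrow>\<^sub>L real"
      using G(1)[of f] that by (simp add: N_def blinfun.diff_left)
    then have "\<exists>c. \<forall>f :: 'a \<Rightarrow>\<^sub>L real. (F - G) f = (\<Sum>i\<in>I. c i * f (x i))"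
      using I linear_blinfun_eval linear_blinfun_apply by (intro linear_functional_combination) auto
    then obtain c where c: "\<forall>f :: 'a \<Rightarrow>\<^sub>L real. (F - G) f = (\<Sum>i\<in>I. c i * f (x i))" ..
    have "F - G = blinfun.prod_left (\<Sum>i\<in>I. c i *\<^sub>R x i)"
      using c by (intro blinfun_eqI) (simp add: blinfun.sum_right blinfun.scaleR_right)
    then have "F - blinfun.prod_left (\<Sum>i\<in>I. c i *\<^sub>R x i) = G" by (simp add: algebra_simps)
    with d[of "\<Sum>i\<in>I. c i *\<^sub>R x i"] G(2) t show False by simp
  qed
  then obtain f where f: "f \<in> N" "t * norm f < F f" by blast
  then have pos: "0 < F f"
    using mult_nonneg_nonneg[OF less_imp_le[OF t(1)] norm_ge_zero[of f]] by linarith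
  define g where "g = (t / F f) *\<^sub>R f"
  have "F g = t" using pos by (simp add: g_def blinfun.scaleR_right)
  moreover have "norm g \<le> 1" using pos f(2) t(1) by (simp add: g_def field_simps)
  moreover have "\<forall>i\<in>I. g (x i) = 0" using f(1) by (simp add: g_def N_def blinfun.scaleR_left)
  ultimately show ?thesis by blast
qed

text \<open>At each stage the vector comes first: all earlier functionals satisfy
  \<open>F f = t\<close>, so Helly's theorem makes them take the value \<open>t\<close> at it. The
  new functional then annihilates all vectors so far including this one, whence the 0 on the
  diagonal.\<close>

lemma james_sequences:
  fixes F :: "('a::real_normed_vector \<Rightarrow>\<^sub>L real) \<Rightarrow>\<^sub>L real"
  assumes d: "\<And>y. d \<le> norm (F - blinfun.prod_left y)" and t: "0 < t" "t < d"
  obtains f :: "nat \<Rightarrow> 'a \<Rightarrow>\<^sub>L real" and x :: "nat \<Rightarrow> 'a"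
  where "\<And>k. norm (f k) \<le> 1" "\<And>m. norm (x m) \<le> norm F + 1"
    "\<And>k m. f k (x m) = (if k < m then t else 0)"
proof -
  define P where "P h n r \<longleftrightarrow> norm (fst r) \<le> 1 \<and> F (fst r) = t \<and> norm (snd r) \<le> norm F + 1 \<and>
      (\<forall>k<n. fst (h k) (snd r) = t) \<and> (\<forall>k<n. fst r (snd (h k)) = 0) \<and> fst r (snd r) = 0"
    for h :: "nat \<Rightarrow> ('a \<Rightarrow>\<^sub>L real) \<times> 'a" and n r
  have "\<exists>h. \<forall>n. P h n (h n)"
  proof (rule dependent_wellorder_choice)
    show "\<And>r h h' n. (\<And>k. k < n \<Longrightarrow> h k = h' k) \<Longrightarrow> P h n r = P h' n r"
      by (simp add: P_def)
  next
    fix n h assume IH: "\<And>k. k < n \<Longrightarrow> P h k (h k)"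
    have "\<exists>y. norm y \<le> norm F + 1 \<and> (\<forall>k\<in>{..<n}. fst (h k) y = F (fst (h k)))"
      by (rule helly_interpolation) simp
    then obtain y where y: "norm y \<le> norm F + 1" "\<And>k. k < n \<Longrightarrow> fst (h k) y = F (fst (h k))"
      by auto
    let ?v = "\<lambda>k. if k < n then snd (h k) else y"
    have "\<exists>g. norm g \<le> 1 \<and> F g = t \<and> (\<forall>k\<in>{..n}. g (?v k) = 0)"
      using d t by (intro bidual_annihilator[of "{..n}" d]) auto
    then obtain g where g: "norm g \<le> 1" "F g = t" "\<forall>k\<in>{..n}. g (?v k) = 0" by blast
    have "g (snd (h k)) = 0" if "k < n" for k using that g(3) by (force dest: bspec[of _ _ k])
    moreover have "g y = 0" using g(3) by (force dest: bspec[of _ _ n])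
    moreover have "fst (h k) y = t" if "k < n" for k using y(2)[OF that] IH[OF that] by (simp add: P_def)
    ultimately have "P h n (g, y)"
      using y(1) g(1,2) by (simp add: P_def)
    then show "\<exists>r. P h n r" by blast
  qed
  then obtain h where h: "\<And>n. P h n (h n)" by blast
  have "fst (h k) (snd (h m)) = (if k < m then t else 0)" for k m
    using h[of k] h[of m] by (cases k m rule: linorder_cases) (auto simp: P_def)
  moreover have "norm (fst (h k)) \<le> 1" "norm (snd (h k)) \<le> norm F + 1" for k
    using h[of k] by (auto simp: P_def)
  ultimately show ?thesis using that[of "\<lambda>k. fst (h k)" "\<lambda>k. snd (h k)"] by blast
qed

definition reflexive :: "'a::real_normed_vector itself \<Rightarrow> bool" where
  "reflexive _ \<longleftrightarrow> (\<forall>F :: ('a \<Rightarrow>\<^sub>L real) \<Rightarrow>\<^sub>L real.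
      \<exists>x. \<forall>f. blinfun_apply F f = blinfun_apply f x)"

text \<open>The canonical embedding is isometric and \<open>X\<close> is complete, so its range is
  closed and a missed element of the bidual has positive distance from it.\<close>

lemma nonreflexive_distance:
  assumes "\<not> reflexive TYPE('a::banach)"
  obtains F :: "('a::banach \<Rightarrow>\<^sub>L real) \<Rightarrow>\<^sub>L real" and d
  where "0 < d" "\<And>y. d \<le> norm (F - blinfun.prod_left y)"
proof -
  let ?J = "blinfun.prod_left :: 'a \<Rightarrow> ('a \<Rightarrow>\<^sub>L real) \<Rightarrow>\<^sub>L real"
  obtain F :: "('a \<Rightarrow>\<^sub>L real) \<Rightarrow>\<^sub>L real" where F: "\<And>x. \<exists>f :: 'a \<Rightarrow>\<^sub>L real. F f \<noteq> f x"
    using assms by (auto simp: reflexive_def)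
  have "norm x \<le> norm (?J x)" for x
  proof -
    obtain f :: "'a \<Rightarrow>\<^sub>L real" where f: "f x = norm x" "norm f \<le> 1" by (rule norming_functional)
    have "norm x \<le> norm (?J x) * norm f" using blinfun_le_norm(2)[of "?J x" f] f(1) by simp
    also have "\<dots> \<le> norm (?J x)" using mult_left_mono[OF f(2) norm_ge_zero[of "?J x"]] by simp
    finally show ?thesis .
  qed
  then have "complete (range ?J)"
    by (intro complete_isometric_image[of 1] blinfun.bounded_linear_prod_left)
      (auto simp: complete_UNIV)
  then have "closed (range ?J)" by (rule complete_imp_closed)
  moreover have "F \<notin> range ?J" using F by force
  ultimately have "0 < infdist F (range ?J)" by (intro infdist_pos_not_in_closed) auto
  moreover have "infdist F (range ?J) \<le> norm (F - ?J y)" for y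
    using infdist_le[of "?J y" "range ?J" F] by (simp add: dist_norm)
  ultimately show ?thesis using that by blast
qed

section \<open>James's theorem on uniformly non-square spaces\<close>

lemma card_filter_Suc:
  "card {i. i < Suc j \<and> Q i} = card {i. i < j \<and> Q i} + (if Q j then 1 else 0)"
proof -
  have "{i. i < Suc j \<and> Q i} = (if Q j then insert j {i. i < j \<and> Q i} else {i. i < j \<and> Q i})"
    by (auto simp: less_Suc_eq)
  then show ?thesis by simp
qed

lemma mod4_cases: "j mod 4 = 0 \<or> j mod 4 = 1 \<or> j mod 4 = 2 \<or> j mod 4 = (3::nat)"
  by linarith
lemma div4_add: "(j + c) div 4 = j div 4 + (j mod 4 + c) div (4::nat)"
proof -
  have "(j + c) div 4 = (j mod 4 + c + 4 * (j div 4)) div 4"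
    by (rule arg_cong[of _ _ "\<lambda>m. m div 4"]) simp
  also have "\<dots> = j div 4 + (j mod 4 + c) div 4" by (subst div_mult_self2) auto
  finally show ?thesis .
qed
lemma div4_shift:
  "(j + 1) div 4 = j div 4 + (if j mod 4 = 3 then 1 else 0::nat)"
  "(j + 2) div 4 = j div 4 + (if j mod 4 = 2 \<or> j mod 4 = 3 then 1 else 0::nat)"
  "(j + 3) div 4 = j div 4 + (if j mod 4 = 0 then 0 else 1::nat)"
  "(j + 4) div 4 = j div 4 + (1::nat)"
  using mod4_cases[of j] by (subst div4_add, elim disjE; simp)+

lemma mult4_add: "(4 * m + c) div 4 = m + c div (4::nat)" "(4 * m + c) mod 4 = c mod (4::nat)"
  by simp_all

lemma double_mod4: "(2 * m) mod 4 \<noteq> 1 \<and> (2 * m) mod 4 \<noteq> (3::nat)"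
proof -
  have "(2 * m) mod 4 = 2 * (m mod 2)" using mult_mod_right[of 2 m 2] by simp
  then show ?thesis by (cases "even m") (simp_all add: even_iff_mod_2_eq_zero odd_iff_mod_2_eq_one)
qed

lemma odd_mod4: "(2 * m + 1) mod 4 = 1 \<or> (2 * m + 1) mod 4 = (3::nat)"
proof -
  have "(2 * m) mod 4 = 2 * (m mod 2)" using mult_mod_right[of 2 m 2] by simp
  then have "(2 * m) mod 4 = 0 \<or> (2 * m) mod 4 = 2"
    by (cases "even m") (simp_all add: even_iff_mod_2_eq_zero odd_iff_mod_2_eq_one)
  then show ?thesis by (auto simp: mod_Suc)
qed

lemma Suc_shift: "Suc j + 1 = j + 2" "Suc j + 2 = j + 3" "Suc j + 3 = j + (4::nat)"
  by simp_all

lemma Suc_div4: "Suc j div 4 = j div 4 + (if j mod 4 = 3 then 1 else 0::nat)"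
  using div4_shift(1)[of j] by simp

text \<open>The residue class of \<open>r\<close> modulo 4 has \<open>(j + 3 - r) div 4\<close>
  members below \<open>j\<close>. Index 0 is exceptional: here it belongs although its residue does
  not. In the counts for \<open>Q\<close> and \<open>D\<close> it is left out although its residue
  belongs, and the correction stands on the left to avoid natural-number subtraction.\<close>

lemma card_residues_P:
  "card {i. i < j \<and> (i = 0 \<or> i mod 4 = 2 \<or> i mod 4 = 3)}
    = (j + 1) div 4 + j div 4 + (if j = 0 then 0 else 1)"
proof (induction j)
  case (Suc j)
  then show ?case unfolding card_filter_Suc Suc.IH Suc_shift div4_shift Suc_div4 by (cases "j = 0") auto
qed simp

lemma card_residues_Q:
  "card {i. i < j \<and> i \<noteq> 0 \<and> (i mod 4 = 0 \<or> i mod 4 = 1)} + (if j = 0 then 0 else 1)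
    = (j + 2) div 4 + (j + 3) div 4"
proof (induction j)
  case (Suc j)
  note mod4_cases[of j]
  then show ?case using Suc.IH unfolding card_filter_Suc Suc_shift div4_shift Suc_div4 by (cases "j = 0") auto
qed simp

lemma card_residues_R:
  "card {i. i < j \<and> (i mod 4 = 1 \<or> i mod 4 = 2)} = (j + 2) div 4 + (j + 1) div (4::nat)"
proof (induction j)
  case (Suc j)
  note mod4_cases[of j]
  then show ?case unfolding card_filter_Suc Suc.IH Suc_shift div4_shift Suc_div4 by auto
qed simp

lemma card_residues_D:
  "card {i. i < j \<and> i \<noteq> 0 \<and> (i mod 4 = 0 \<or> i mod 4 = 3)} + (if j = 0 then 0 else 1)
    = j div 4 + (j + 3) div 4"
proof (induction j)
  case (Suc j)
  note mod4_cases[of j]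
  then show ?case using Suc.IH unfolding card_filter_Suc Suc_shift div4_shift Suc_div4 by (cases "j = 0") auto
qed simp

text \<open>The index patterns of the endpoints of interlacing blocks: if \<open>P\<close> and \<open>Q\<close> are the endpoints
  of \<open>n\<close> alternating blocks each, the blocks of \<open>Q\<close> agree in sign with those of \<open>P\<close> on the
  blocks of \<open>R\<close> and are opposite to them on the blocks of \<open>D\<close>.\<close>

definition pattern_P :: "nat \<Rightarrow> nat set" where
  "pattern_P n = {i. i < 4 * n - 1 \<and> (i = 0 \<or> i mod 4 = 2 \<or> i mod 4 = 3)}"

definition pattern_Q :: "nat \<Rightarrow> nat set" where
  "pattern_Q n = {i. i < 4 * n + 1 \<and> i \<noteq> 0 \<and> (i mod 4 = 0 \<or> i mod 4 = 1)}"

definition pattern_R :: "nat \<Rightarrow> nat set" where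
  "pattern_R n = {i. i < 4 * n - 1 \<and> (i mod 4 = 1 \<or> i mod 4 = 2)}"

definition pattern_D :: "nat \<Rightarrow> nat set" where
  "pattern_D n = {i. i < 4 * n - 3 \<and> i \<noteq> 0 \<and> (i mod 4 = 0 \<or> i mod 4 = 3)}"

lemmas pattern_defs = pattern_P_def pattern_Q_def pattern_R_def pattern_D_def

lemma finite_pattern [simp]:
  "finite (pattern_P n)" "finite (pattern_Q n)" "finite (pattern_R n)" "finite (pattern_D n)"
  by (auto simp: pattern_defs)

lemma card_pattern:
  assumes "1 \<le> n"
  shows "card (pattern_P n) = 2 * n" "card (pattern_Q n) = 2 * n"
    "card (pattern_R n) = 2 * n" "card (pattern_D n) = 2 * (n - 1)"
proof -
  obtain m where n: "n = m + 1" using assms by (metis add.commute le_Suc_ex)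
  have e: "4 * n - 1 = 4 * m + 3" "4 * n + 1 = 4 * m + 5" "4 * n - 3 = 4 * m + 1" by (auto simp: n)
  show "card (pattern_P n) = 2 * n" "card (pattern_Q n) = 2 * n"
    "card (pattern_R n) = 2 * n" "card (pattern_D n) = 2 * (n - 1)"
    using card_residues_P[of "4 * m + 3"] card_residues_Q[of "4 * m + 5"]
      card_residues_R[of "4 * m + 3"] card_residues_D[of "4 * m + 1"]
    unfolding pattern_defs e add.assoc mult4_add by (simp_all add: n)
qed

lemma card_Int_filter:
  "card ({i. i < b \<and> Q i} \<inter> {..<j}) = card {i. i < min j b \<and> Q (i::nat)}"
  by (rule arg_cong[of _ _ card]) auto

text \<open>As half-open intervals the blocks of \<open>P\<close> are [0,2), [3,6), [7,10), ... and
  those of \<open>Q\<close> are [1,4), [5,8), [9,12), .... Block \<open>m\<close> of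
  \<open>P\<close> meets block \<open>m\<close> of \<open>Q\<close> in a block of \<open>R\<close>,
  with equal signs; block \<open>m\<close> of \<open>Q\<close> meets block \<open>m + 1\<close> of
  \<open>P\<close> in a block of \<open>D\<close>, with opposite signs, and this happens only
  \<open>n - 1\<close> times. An odd count says that position \<open>j - 1\<close> lies in a block;
  residue 1 or 3 is its sign.\<close>

lemma pattern_signs:
  assumes "1 \<le> n"
  shows "card (pattern_R n \<inter> {..<j}) mod 4 = 1 \<Longrightarrow>
      card (pattern_P n \<inter> {..<j}) mod 4 = 1 \<and> card (pattern_Q n \<inter> {..<j}) mod 4 = 1" (is "?R1 \<Longrightarrow> ?A")
    and "card (pattern_R n \<inter> {..<j}) mod 4 = 3 \<Longrightarrow>
      card (pattern_P n \<inter> {..<j}) mod 4 = 3 \<and> card (pattern_Q n \<inter> {..<j}) mod 4 = 3" (is "?R3 \<Longrightarrow> ?B")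
    and "card (pattern_D n \<inter> {..<j}) mod 4 = 1 \<Longrightarrow>
      card (pattern_P n \<inter> {..<j}) mod 4 = 3 \<and> card (pattern_Q n \<inter> {..<j}) mod 4 = 1" (is "?D1 \<Longrightarrow> ?C")
    and "card (pattern_D n \<inter> {..<j}) mod 4 = 3 \<Longrightarrow>
      card (pattern_P n \<inter> {..<j}) mod 4 = 1 \<and> card (pattern_Q n \<inter> {..<j}) mod 4 = 3" (is "?D3 \<Longrightarrow> ?E")
proof -
  define p where "p = card (pattern_P n \<inter> {..<j})"
  define q where "q = card (pattern_Q n \<inter> {..<j})"
  define r where "r = card (pattern_R n \<inter> {..<j})"
  define d where "d = card (pattern_D n \<inter> {..<j})"
  have r: "r = (min j (4 * n - 1) + 2) div 4 + (min j (4 * n - 1) + 1) div 4"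
    unfolding r_def pattern_R_def card_Int_filter card_residues_R ..
  have d: "d + (if min j (4 * n - 3) = 0 then 0 else 1) = min j (4 * n - 3) div 4 + (min j (4 * n - 3) + 3) div 4"
    unfolding d_def pattern_D_def card_Int_filter card_residues_D ..
  have p: "p = (min j (4 * n - 1) + 1) div 4 + min j (4 * n - 1) div 4 + (if min j (4 * n - 1) = 0 then 0 else 1)"
    unfolding p_def pattern_P_def card_Int_filter card_residues_P ..
  have q: "q + (if min j (4 * n + 1) = 0 then 0 else 1) = (min j (4 * n + 1) + 2) div 4 + (min j (4 * n + 1) + 3) div 4"
    unfolding q_def pattern_Q_def card_Int_filter card_residues_Q ..
  have *: "(r mod 4 = 1 \<longrightarrow> p mod 4 = 1 \<and> q mod 4 = 1) \<and> (r mod 4 = 3 \<longrightarrow> p mod 4 = 3 \<and> q mod 4 = 3)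
      \<and> (d mod 4 = 1 \<longrightarrow> p mod 4 = 3 \<and> q mod 4 = 1) \<and> (d mod 4 = 3 \<longrightarrow> p mod 4 = 1 \<and> q mod 4 = 3)"
  proof (cases "j = 0")
    case True
    then show ?thesis using r d by simp
  next
    case False
    \<comment> \<open>Past the last endpoint the count is even, so the position lies in no block and
      there is no sign to check.\<close>
    have r_big: "r = 2 * n" if "4 * n - 1 \<le> j"
    proof -
      obtain m where n: "n = m + 1" using assms by (metis add.commute le_Suc_ex)
      have e: "min j (4 * n - 1) = 4 * m + 3" using that by (auto simp: n)
      show ?thesis using r unfolding e add.assoc mult4_add by (simp add: n)
    qed
    have d_big: "d = 2 * n - 2" if "4 * n - 3 \<le> j"
    proof -
      obtain m where n: "n = m + 1" using assms by (metis add.commute le_Suc_ex)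
      have e: "min j (4 * n - 3) = 4 * m + 1" using that by (auto simp: n)
      show ?thesis using d unfolding e add.assoc mult4_add by (simp add: n)
    qed
    have pq: "p = (j + 1) div 4 + j div 4 + 1" "q + 1 = (j + 2) div 4 + (j + 3) div 4" if "j < 4 * n - 1"
    proof -
      have e: "min j (4 * n - 1) = j" "min j (4 * n + 1) = j" using that by auto
      show "p = (j + 1) div 4 + j div 4 + 1" "q + 1 = (j + 2) div 4 + (j + 3) div 4"
        using False p q unfolding e by auto
    qed
    have r_small: "r = (j + 2) div 4 + (j + 1) div 4" if "j < 4 * n - 1"
      using that r by (simp add: min_def)
    have d_small: "d + 1 = j div 4 + (j + 3) div 4" if "j < 4 * n - 3"
      using that d False by (simp add: min_def)
    \<comment> \<open>Apart from index 0, every pattern has two endpoints in each four indices, so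
      advancing by 8 adds 4 to each count. Hence the signs depend only on \<open>j mod 8\<close>,
      and the eight cases can be computed.\<close>
    define v i where "v = j div 8" and "i = j mod 8"
    have j8: "j = 8 * v + i" and "i < 8" by (simp_all add: v_def i_def)
    then have i_cases: "i = 0 \<or> i = 1 \<or> i = 2 \<or> i = 3 \<or> i = 4 \<or> i = 5 \<or> i = 6 \<or> i = 7"
      by linarith
    have div8: "(j + c) div 4 = 2 * v + (i + c) div 4" for c
      using mult4_add(1)[of "2 * v" "i + c"] by (simp add: j8 add.assoc)
    have pq_mod: "p mod 4 = ((i + 1) div 4 + (i + 0) div 4 + 1) mod 4"
      "(q + 1) mod 4 = ((i + 2) div 4 + (i + 3) div 4) mod 4" if "j < 4 * n - 1"
    proof -
      have "p = 4 * v + ((i + 1) div 4 + (i + 0) div 4 + 1)"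
        using pq(1)[OF that] div8[of 1] div8[of 0] by simp
      then show "p mod 4 = ((i + 1) div 4 + (i + 0) div 4 + 1) mod 4" by (simp only: mult4_add(2))
      have "q + 1 = 4 * v + ((i + 2) div 4 + (i + 3) div 4)"
        using pq(2)[OF that] div8[of 2] div8[of 3] by simp
      then show "(q + 1) mod 4 = ((i + 2) div 4 + (i + 3) div 4) mod 4"
        by (simp only: mult4_add(2))
    qed
    have r_mod: "r mod 4 = ((i + 2) div 4 + (i + 1) div 4) mod 4" if "j < 4 * n - 1"
    proof -
      have "r = 4 * v + ((i + 2) div 4 + (i + 1) div 4)"
        using r_small[OF that] div8[of 1] div8[of 2] by simp
      then show ?thesis by (simp only: mult4_add(2))
    qed
    have d_mod: "(d + 1) mod 4 = ((i + 0) div 4 + (i + 3) div 4) mod 4" if "j < 4 * n - 3"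
    proof -
      have "d + 1 = 4 * v + ((i + 0) div 4 + (i + 3) div 4)"
        using d_small[OF that] div8[of 0] div8[of 3] by simp
      then show ?thesis by (simp only: mult4_add(2))
    qed
    have Suc_mod: "(m + 1) mod 4 = (if m mod 4 = 3 then 0 else m mod 4 + 1)" for m :: nat
      by (simp add: mod_Suc)
    have even4: "(2 * n) mod 4 \<noteq> 1 \<and> (2 * n) mod 4 \<noteq> 3" "(2 * n - 2) mod 4 \<noteq> 1 \<and> (2 * n - 2) mod 4 \<noteq> 3"
      using double_mod4[of n] double_mod4[of "n - 1"] unfolding diff_mult_distrib2 mult_1_right
      by blast+
    have R: "(r mod 4 = 1 \<longrightarrow> p mod 4 = 1 \<and> q mod 4 = 1) \<and> (r mod 4 = 3 \<longrightarrow> p mod 4 = 3 \<and> q mod 4 = 3)"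
    proof (cases "j < 4 * n - 1")
      case True
      show ?thesis
        using i_cases pq_mod[OF True] r_mod[OF True] unfolding Suc_mod
        by (elim disjE) (simp_all split: if_splits)
    next
      case False
      then show ?thesis using r_big even4 by simp
    qed
    have D: "(d mod 4 = 1 \<longrightarrow> p mod 4 = 3 \<and> q mod 4 = 1) \<and> (d mod 4 = 3 \<longrightarrow> p mod 4 = 1 \<and> q mod 4 = 3)"
    proof (cases "j < 4 * n - 3")
      case True
      then have less: "j < 4 * n - 1" by linarith
      show ?thesis
        using i_cases pq_mod[OF less] d_mod[OF True] unfolding Suc_mod
        by (elim disjE) (simp_all split: if_splits)
    next
      case False
      then show ?thesis using d_big even4 by simp
    qed
    from R D show ?thesis by blast
  qed
  from * show "?R1 \<Longrightarrow> ?A" "?R3 \<Longrightarrow> ?B" "?D1 \<Longrightarrow> ?C" "?D3 \<Longrightarrow> ?E"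
    unfolding p_def q_def r_def d_def by blast+
qed

text \<open>The threshold \<open>j\<close> does not depend on \<open>A\<close>, so the counts for
  all four patterns, transported by \<open>h\<close>, are compared at the same place.\<close>

lemma card_image_le_strict_mono:
  assumes h: "strict_mono (h :: nat \<Rightarrow> nat)"
  obtains j where "\<And>A. card {p \<in> h ` A. p \<le> k} = card (A \<inter> {..<j})"
proof -
  define j where "j = (LEAST i. k < h i)"
  have ex: "k < h (Suc k)" using strict_mono_imp_increasing[OF h, of "Suc k"] by simp
  have iff: "h i \<le> k \<longleftrightarrow> i < j" for i
  proof
    assume "h i \<le> k"
    moreover have "k < h j" unfolding j_def using ex by (rule LeastI)
    ultimately show "i < j" using strict_mono_less[OF h, of i j] by simp
  next
    assume "i < j"
    then show "h i \<le> k" unfolding j_def using not_less_Least by fastforce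
  qed
  have "card {p \<in> h ` A. p \<le> k} = card (A \<inter> {..<j})" for A
  proof -
    have "{p \<in> h ` A. p \<le> k} = h ` (A \<inter> {..<j})" using iff by auto
    moreover have "inj_on h (A \<inter> {..<j})"
      using strict_mono_eq[OF h] by (simp add: inj_on_def)
    ultimately show ?thesis by (simp add: card_image)
  qed
  then show ?thesis using that by blast
qed

text \<open>Colouring the sets of size \<open>2 * n\<close> by the integer part of
  \<open>g P / e\<close> uses finitely many colours, as \<open>g\<close> is bounded for each
  \<open>n\<close>. The sizes up to \<open>N\<close> are handled one after the other on shrinking
  infinite sets.\<close>

lemma nested_ramsey:
  fixes g :: "nat set \<Rightarrow> real"
  assumes e: "0 < e" and g: "\<And>P n. finite P \<Longrightarrow> card P = 2 * n \<Longrightarrow> 0 \<le> g P \<and> g P \<le> B n"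
  shows "\<exists>H. infinite H \<and> (\<forall>n\<le>N. \<exists>a. \<forall>P. P \<subseteq> H \<and> finite P \<and> card P = 2 * n \<longrightarrow> a \<le> g P \<and> g P < a + e)"
proof -
  have step: "\<exists>H'. H' \<subseteq> H \<and> infinite H' \<and>
      (\<exists>a. \<forall>P. P \<subseteq> H' \<and> finite P \<and> card P = 2 * n \<longrightarrow> a \<le> g P \<and> g P < a + e)"
    if H: "infinite H" for H and n :: nat
  proof -
    define col where "col P = nat \<lfloor>g P / e\<rfloor>" for P
    have "col P < Suc (nat \<lfloor>B n / e\<rfloor>)" if "finite P" "card P = 2 * n" for P
    proof -
      have "g P / e \<le> B n / e" using g[OF that] e by (simp add: divide_right_mono)
      then show ?thesis unfolding col_def by (intro le_imp_less_Suc nat_mono floor_mono)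
    qed
    then obtain H' c where H': "H' \<subseteq> H" "infinite H'"
      and c: "\<And>P. P \<subseteq> H' \<Longrightarrow> finite P \<Longrightarrow> card P = 2 * n \<Longrightarrow> col P = c"
      using Ramsey[of H "2 * n" col "Suc (nat \<lfloor>B n / e\<rfloor>)"] H by (metis (no_types, lifting))
    have "real c * e \<le> g P \<and> g P < real c * e + e" if "P \<subseteq> H'" "finite P" "card P = 2 * n" for P
    proof -
      have nn: "0 \<le> g P / e" using g[OF that(2,3)] e by simp
      have "real c = of_int \<lfloor>g P / e\<rfloor>"
        using c[OF that] nn by (simp add: col_def flip: of_nat_nat)
      then have "real c \<le> g P / e" "g P / e < real c + 1"
        by linarith+
      then show ?thesis using e by (simp add: field_simps)
    qed
    with H' show ?thesis by blast
  qed
  show ?thesis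
  proof (induction N)
    case 0
    then show ?case using step[of UNIV 0] by auto
  next
    case (Suc N)
    then obtain H where H: "infinite H"
      "\<forall>n\<le>N. \<exists>a. \<forall>P. P \<subseteq> H \<and> finite P \<and> card P = 2 * n \<longrightarrow> a \<le> g P \<and> g P < a + e"
      by blast
    obtain H' where H': "H' \<subseteq> H" "infinite H'"
      "\<exists>a. \<forall>P. P \<subseteq> H' \<and> finite P \<and> card P = 2 * Suc N \<longrightarrow> a \<le> g P \<and> g P < a + e"
      using step[OF H(1), of "Suc N"] by blast
    have "\<exists>a. \<forall>P. P \<subseteq> H' \<and> finite P \<and> card P = 2 * n \<longrightarrow> a \<le> g P \<and> g P < a + e" if "n \<le> Suc N" for n
    proof (cases "n = Suc N")
      case False
      with that have "n \<le> N" by simp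
      with H(2) obtain a where "\<forall>P. P \<subseteq> H \<and> finite P \<and> card P = 2 * n \<longrightarrow> a \<le> g P \<and> g P < a + e" by blast
      with H'(1) show ?thesis by (meson subset_trans)
    qed (use H'(3) in simp)
    with H'(2) show ?case by blast
  qed
qed

section \<open>Vectors with alternating blocks and their least norm\<close>

locale james_system =
  fixes f :: "nat \<Rightarrow> 'a::real_normed_vector \<Rightarrow>\<^sub>L real" and x :: "nat \<Rightarrow> 'a" and t C :: real
  assumes t_pos: "0 < t" and norm_f: "norm (f k) \<le> 1" and norm_x: "norm (x m) \<le> C"
    and f_x: "f k (x m) = (if k < m then t else 0)"
begin

text \<open>The vectors on which the functionals have alternating signs along the consecutive blocks
  \<open>[p\<^sub>1, p\<^sub>2), [p\<^sub>3, p\<^sub>4), \<dots>\<close> where \<open>p\<^sub>1 < p\<^sub>2 < \<dots>\<close> are the elements of \<open>P\<close>.\<close>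

definition blocks :: "nat set \<Rightarrow> 'a set" where
  "blocks P = {z. \<forall>k. (card {p \<in> P. p \<le> k} mod 4 = 1 \<longrightarrow> t \<le> f k z) \<and>
                      (card {p \<in> P. p \<le> k} mod 4 = 3 \<longrightarrow> f k z \<le> - t)}"

definition gauge :: "nat set \<Rightarrow> real" where
  "gauge P = (INF z\<in>blocks P. norm z)"

definition sig :: "nat \<Rightarrow> real" where
  "sig m = (if m mod 4 = 1 then 1 else if m mod 4 = 3 then - 1 else 0)"

text \<open>On \<open>x b - x a\<close> the functional \<open>f k\<close> equals \<open>t\<close>
  for \<open>a \<le> k < b\<close> and 0 elsewhere. Such differences over consecutive pairs of
  \<open>P\<close>, with alternating signs, add up to the vector. It has \<open>2 * n\<close> terms
  of norm at most \<open>C\<close>: this is the linear bound that geometric growth will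
  contradict.\<close>

lemma alternating_vector:
  assumes "finite P" "card P = 2 * n"
  shows "\<exists>z. norm z \<le> 2 * real n * C \<and> (\<forall>k. f k z = t * sig (card {p \<in> P. p \<le> k}))"
  using assms
proof (induction n arbitrary: P)
  case 0
  then show ?case by (intro exI[of _ 0]) (simp add: sig_def)
next
  case (Suc n)
  define b where "b = Max P"
  define a where "a = Max (P - {b})"
  define P0 where "P0 = P - {b} - {a}"
  have "P \<noteq> {}" using Suc.prems by auto
  then have bP: "b \<in> P" "\<And>p. p \<in> P \<Longrightarrow> p \<le> b"
    using Max_in[of P] Max_ge[of P] Suc.prems(1) unfolding b_def by blast+
  have c1: "card (P - {b}) = Suc (2 * n)" using Suc.prems bP by simp
  then have "P - {b} \<noteq> {}" by (metis card.empty nat.distinct(1))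
  then have aP: "a \<in> P - {b}" "\<And>p. p \<in> P - {b} \<Longrightarrow> p \<le> a"
    using Max_in[of "P - {b}"] Max_ge[of "P - {b}"] Suc.prems(1) unfolding a_def by blast+
  have ab: "a < b" using aP(1) bP(2)[of a] by auto
  have P0: "finite P0" "card P0 = 2 * n" using Suc.prems c1 aP(1) by (auto simp: P0_def)
  have P0a: "p < a" if "p \<in> P0" for p using aP(2)[of p] that by (auto simp: P0_def le_less)
  have P: "P = insert a (insert b P0)" "a \<notin> P0" "b \<notin> P0" using aP(1) bP(1) by (auto simp: P0_def)
  obtain z0 where z0: "norm z0 \<le> 2 * real n * C" "\<And>k. f k z0 = t * sig (card {p \<in> P0. p \<le> k})"
    using Suc.IH[OF P0] by blast
  \<comment> \<open>For \<open>a \<le> k < b\<close> exactly \<open>2 * n + 1\<close> elements of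
    \<open>P\<close> are at most \<open>k\<close>, so this is the sign required on the last
    block.\<close>
  define s where "s = sig (2 * n + 1)"
  have s: "\<bar>s\<bar> = 1" unfolding s_def sig_def using odd_mod4[of n] by auto
  define z where "z = z0 + s *\<^sub>R (x b - x a)"
  have "norm z \<le> norm z0 + \<bar>s\<bar> * norm (x b - x a)"
    unfolding z_def by (metis norm_scaleR norm_triangle_ineq)
  also have "\<dots> \<le> 2 * real n * C + (C + C)"
    unfolding s using z0(1) norm_triangle_ineq4[of "x b" "x a"] norm_x[of a] norm_x[of b] by linarith
  finally have nz: "norm z \<le> 2 * real (Suc n) * C" by (simp add: algebra_simps)
  have fz: "f k z = t * sig (card {p \<in> P0. p \<le> k}) + s * ((if k < b then t else 0) - (if k < a then t else 0))" for k
    by (simp add: z_def blinfun.add_right blinfun.scaleR_right blinfun.diff_right z0(2) f_x)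
  have "f k z = t * sig (card {p \<in> P. p \<le> k})" for k
  proof (cases "k < a")
    case True
    then have "{p \<in> P. p \<le> k} = {p \<in> P0. p \<le> k}" using ab by (auto simp: P(1))
    then show ?thesis using fz[of k] True ab by simp
  next
    case False
    then have P0k: "{p \<in> P0. p \<le> k} = P0" by (auto dest: P0a)
    then have c0: "card {p \<in> P0. p \<le> k} = 2 * n" using P0(2) by simp
    have sig0: "sig (2 * n) = 0" "sig (2 * n + 2) = 0"
      using double_mod4[of n] double_mod4[of "n + 1"] unfolding sig_def distrib_left mult_1_right
      by (simp_all only: if_False if_True simp_thms)
    show ?thesis
    proof (cases "k < b")
      case True
      then have "{p \<in> P. p \<le> k} = insert a P0"
        using False by (auto simp: P(1) dest: P0a)
      then have c: "card {p \<in> P. p \<le> k} = 2 * n + 1" using P(2) P0 by simp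
      have "f k z = s * t" using fz[of k] True False by (simp add: c0 sig0)
      then show ?thesis unfolding c s_def by (rule trans) (rule mult.commute)
    next
      case F2: False
      then have "{p \<in> P. p \<le> k} = P" by (auto dest: bP(2))
      then have c: "card {p \<in> P. p \<le> k} = 2 * n + 2" using Suc.prems(2) by simp
      show ?thesis using fz[of k] F2 False unfolding c c0 sig0 by simp
    qed
  qed
  with nz show ?case by blast
qed

lemma blocks_bounded_element:
  assumes "finite P" "card P = 2 * n"
  shows "\<exists>z\<in>blocks P. norm z \<le> 2 * real n * C"
proof -
  obtain z where z: "norm z \<le> 2 * real n * C" "\<And>k. f k z = t * sig (card {p \<in> P. p \<le> k})"
    using alternating_vector[OF assms] by blast
  then have "z \<in> blocks P" by (auto simp: blocks_def sig_def)
  with z(1) show ?thesis by blast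
qed

lemma bdd_below_norm_image: "bdd_below (norm ` S)"
  by (rule bdd_belowI2[of _ 0]) simp

lemma gauge_le: "z \<in> blocks P \<Longrightarrow> gauge P \<le> norm z"
  unfolding gauge_def by (intro cINF_lower bdd_below_norm_image)

lemma gauge_less:
  assumes "finite P" "card P = 2 * n" "gauge P < a"
  obtains z where "z \<in> blocks P" "norm z < a"
proof -
  have "blocks P \<noteq> {}" using blocks_bounded_element[OF assms(1,2)] by blast
  then have "\<exists>y\<in>norm ` blocks P. y < a"
    using assms(3) cInf_lessD[of "norm ` blocks P" a] by (auto simp: gauge_def)
  with that show ?thesis by blast
qed

lemma gauge_ge:
  assumes "finite P" "card P = 2 * n" "\<And>z. z \<in> blocks P \<Longrightarrow> a \<le> norm z"
  shows "a \<le> gauge P"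
proof -
  have "blocks P \<noteq> {}" using blocks_bounded_element[OF assms(1,2)] by blast
  then show ?thesis unfolding gauge_def by (rule cINF_greatest) (rule assms(3))
qed

lemma gauge_bounds:
  assumes "finite P" "card P = 2 * n"
  shows "0 \<le> gauge P" "gauge P \<le> 2 * real n * C"
proof -
  show "0 \<le> gauge P" by (rule gauge_ge[OF assms]) simp
  show "gauge P \<le> 2 * real n * C"
    using blocks_bounded_element[OF assms] gauge_le[of _ P] by (blast intro: order_trans)
qed

text \<open>The first endpoint alone forces \<open>t \<le> f (Min P) z\<close>. This positive lower
  bound starts the geometric growth.\<close>

lemma gauge_ge_t:
  assumes "finite P" "card P = 2 * n" "1 \<le> n"
  shows "t \<le> gauge P"
proof (rule gauge_ge[OF assms(1,2)])
  fix z assume z: "z \<in> blocks P"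
  have "P \<noteq> {}" using assms(2,3) by auto
  then have "Min P \<in> P" using assms(1) by (rule Min_in[rotated])
  moreover have "p = Min P" if "p \<in> P" "p \<le> Min P" for p
    using Min_le[OF assms(1) that(1)] that(2) by (rule antisym[rotated])
  ultimately have "{p \<in> P. p \<le> Min P} = {Min P}" by blast
  then have "t \<le> f (Min P) z" using z by (auto simp: blocks_def)
  then show "t \<le> norm z" using blinfun_le_norm1(1)[OF norm_f, of "Min P" z] by linarith
qed

text \<open>On a block of \<open>R\<close> both vectors satisfy the same inequality, on a block of
  \<open>D\<close> opposite ones, and the averages inherit them. This is why \<open>blocks\<close>
  asks for nothing off the blocks: prescribed zeros there would be lost under averaging.\<close>

lemma blocks_interlacing:
  assumes h: "strict_mono h" and n: "1 \<le> n"
    and z: "z \<in> blocks (h ` pattern_P n)" and y: "y \<in> blocks (h ` pattern_Q n)"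
  shows "(1/2) *\<^sub>R (z + y) \<in> blocks (h ` pattern_R n)"
    and "(1/2) *\<^sub>R (y - z) \<in> blocks (h ` pattern_D n)"
proof -
  have "(card {p \<in> h ` pattern_R n. p \<le> k} mod 4 = 1 \<longrightarrow> t \<le> f k ((1/2) *\<^sub>R (z + y))) \<and>
      (card {p \<in> h ` pattern_R n. p \<le> k} mod 4 = 3 \<longrightarrow> f k ((1/2) *\<^sub>R (z + y)) \<le> - t) \<and>
      (card {p \<in> h ` pattern_D n. p \<le> k} mod 4 = 1 \<longrightarrow> t \<le> f k ((1/2) *\<^sub>R (y - z))) \<and>
      (card {p \<in> h ` pattern_D n. p \<le> k} mod 4 = 3 \<longrightarrow> f k ((1/2) *\<^sub>R (y - z)) \<le> - t)" for k
  proof -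
    obtain j where j: "\<And>A. card {p \<in> h ` A. p \<le> k} = card (A \<inter> {..<j})"
      using card_image_le_strict_mono[OF h] by blast
    have zk: "card (pattern_P n \<inter> {..<j}) mod 4 = 1 \<Longrightarrow> t \<le> f k z"
      "card (pattern_P n \<inter> {..<j}) mod 4 = 3 \<Longrightarrow> f k z \<le> - t"
      using z unfolding blocks_def mem_Collect_eq by (metis j)+
    have yk: "card (pattern_Q n \<inter> {..<j}) mod 4 = 1 \<Longrightarrow> t \<le> f k y"
      "card (pattern_Q n \<inter> {..<j}) mod 4 = 3 \<Longrightarrow> f k y \<le> - t"
      using y unfolding blocks_def mem_Collect_eq by (metis j)+
    have eq: "f k ((1/2) *\<^sub>R (z + y)) = (f k z + f k y) / 2" "f k ((1/2) *\<^sub>R (y - z)) = (f k y - f k z) / 2"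
      by (simp_all only: blinfun.scaleR_right blinfun.add_right blinfun.diff_right real_scaleR_def)
    show ?thesis
      unfolding j eq
    proof (intro conjI impI)
      assume "card (pattern_R n \<inter> {..<j}) mod 4 = 1"
      from pattern_signs(1)[OF n this] zk(1) yk(1) show "t \<le> (f k z + f k y) / 2" by simp
    next
      assume "card (pattern_R n \<inter> {..<j}) mod 4 = 3"
      from pattern_signs(2)[OF n this] zk(2) yk(2) show "(f k z + f k y) / 2 \<le> - t" by simp
    next
      assume "card (pattern_D n \<inter> {..<j}) mod 4 = 1"
      from pattern_signs(3)[OF n this] zk(2) yk(1) show "t \<le> (f k y - f k z) / 2" by simp
    next
      assume "card (pattern_D n \<inter> {..<j}) mod 4 = 3"
      from pattern_signs(4)[OF n this] zk(1) yk(2) show "(f k y - f k z) / 2 \<le> - t" by simp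
    qed
  qed
  note signs = this
  show "(1/2) *\<^sub>R (z + y) \<in> blocks (h ` pattern_R n)"
    unfolding blocks_def mem_Collect_eq
    by (rule allI, rule conjI[OF conjunct1[OF signs] conjunct1[OF conjunct2[OF signs]]])
  show "(1/2) *\<^sub>R (y - z) \<in> blocks (h ` pattern_D n)"
    unfolding blocks_def mem_Collect_eq
    by (rule allI, rule conjunct2[OF conjunct2[OF signs]])
qed

end

section \<open>Uniform non-squareness and growth of the gauge\<close>

definition uniformly_nonsquare :: "'a::real_normed_vector itself \<Rightarrow> bool" where
  "uniformly_nonsquare _ \<longleftrightarrow>
     (\<exists>c>0. \<forall>x y::'a. norm x \<le> 1 \<longrightarrow> norm y \<le> 1 \<longrightarrow> norm (x + y) \<le> 2 - c \<or> norm (x - y) \<le> 2 - c)"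

lemma uniformly_nonsquare_scaled:
  assumes "uniformly_nonsquare TYPE('a::real_normed_vector)"
  obtains c where "0 < c" "c \<le> 1"
    "\<And>(x::'a) y A. 0 < A \<Longrightarrow> norm x \<le> A \<Longrightarrow> norm y \<le> A \<Longrightarrow>
      norm ((1/2) *\<^sub>R (x + y)) \<le> (1 - c / 2) * A \<or> norm ((1/2) *\<^sub>R (y - x)) \<le> (1 - c / 2) * A"
proof -
  obtain c0 where c0: "0 < c0" and nsq: "\<And>x y::'a. norm x \<le> 1 \<Longrightarrow> norm y \<le> 1 \<Longrightarrow>
      norm (x + y) \<le> 2 - c0 \<or> norm (x - y) \<le> 2 - c0"
    using assms by (auto simp: uniformly_nonsquare_def)
  define c where "c = min c0 1"
  have "norm ((1/2) *\<^sub>R (x + y)) \<le> (1 - c / 2) * A \<or> norm ((1/2) *\<^sub>R (y - x)) \<le> (1 - c / 2) * A"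
    if A: "0 < A" and xy: "norm x \<le> A" "norm y \<le> A" for x y :: 'a and A
  proof -
    have "norm (x /\<^sub>R A) \<le> 1" "norm (y /\<^sub>R A) \<le> 1" using A xy by (simp_all add: field_simps)
    then have "norm (x /\<^sub>R A + y /\<^sub>R A) \<le> 2 - c0 \<or> norm (x /\<^sub>R A - y /\<^sub>R A) \<le> 2 - c0" by (rule nsq)
    then have "norm ((x + y) /\<^sub>R A) \<le> 2 - c \<or> norm ((x - y) /\<^sub>R A) \<le> 2 - c"
      by (auto simp: c_def scaleR_add_right scaleR_diff_right)
    moreover have "norm (v /\<^sub>R A) = norm v / A" for v :: 'a using A by (simp add: divide_inverse_commute)
    ultimately have "norm (x + y) \<le> (2 - c) * A \<or> norm (x - y) \<le> (2 - c) * A"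
      using A by (simp add: pos_divide_le_eq)
    then have "norm (x + y) \<le> (2 - c) * A \<or> norm (y - x) \<le> (2 - c) * A"
      by (simp add: norm_minus_commute)
    moreover have "norm ((1/2) *\<^sub>R v) = norm v / 2" for v :: 'a by simp
    ultimately show ?thesis unfolding left_diff_distrib by (elim disjE) simp_all
  qed
  moreover have "0 < c" "c \<le> 1" using c0 by (auto simp: c_def)
  ultimately show ?thesis using that by blast
qed

text \<open>Bernoulli's inequality gives only linear growth; applied to the exponent
  \<open>m\<close> and squared, it gives a quadratic lower bound for the exponent
  \<open>2 * m\<close>.\<close>

lemma power_dominates_linear:
  fixes u K L :: real
  assumes "0 < u" "0 < K"
  shows "\<exists>N. L * (real N + 1) < K * (1 + u) ^ N"
proof -
  obtain m :: nat where m: "3 * \<bar>L\<bar> / (K * u\<^sup>2) < real m" using reals_Archimedean2 by blast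
  then have m_pos: "0 < real m"
    by (rule order.strict_trans1[rotated]) (use assms in simp)
  then have m1: "1 \<le> real m" by simp
  have pos: "0 < K * u\<^sup>2" using assms by simp
  have "L * (real (2 * m) + 1) \<le> \<bar>L\<bar> * (real (2 * m) + 1)" by (intro mult_right_mono) auto
  also have "\<dots> \<le> \<bar>L\<bar> * (3 * real m)" using m1 by (intro mult_left_mono) auto
  also have "\<dots> = (3 * \<bar>L\<bar>) * real m" by simp
  also have "\<dots> < (real m * (K * u\<^sup>2)) * real m"
    using m pos m_pos by (intro mult_strict_right_mono) (simp_all add: pos_divide_less_eq)
  also have "\<dots> = K * (real m * u)\<^sup>2" by (simp add: power2_eq_square)
  also have "\<dots> \<le> K * ((1 + u) ^ m)\<^sup>2"
  proof (intro mult_left_mono power_mono)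
    show "real m * u \<le> (1 + u) ^ m" using Bernoulli_inequality[of u m] assms by linarith
  qed (use assms in auto)
  also have "\<dots> = K * (1 + u) ^ (2 * m)" by (simp add: power_mult[symmetric] mult.commute)
  finally show ?thesis by blast
qed

text \<open>By Ramsey's theorem the gauge of \<open>n\<close> blocks is nearly a constant \<open>a n\<close> on an infinite set. The
  half sum and half difference of two interlacing vectors of nearly minimal norm have \<open>n\<close> and
  \<open>n - 1\<close> blocks, so non-squareness makes \<open>a n\<close> grow geometrically, although it is \<open>O(n)\<close>.\<close>

theorem uniformly_nonsquare_imp_reflexive:
  assumes nsq: "uniformly_nonsquare TYPE('a::banach)"
  shows "reflexive TYPE('a)"
proof (rule ccontr)
  assume "\<not> reflexive TYPE('a)"
  then obtain F :: "('a \<Rightarrow>\<^sub>L real) \<Rightarrow>\<^sub>L real" and d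
    where d: "0 < d" "\<And>y. d \<le> norm (F - blinfun.prod_left y)" using nonreflexive_distance by blast
  define t where "t = d / 2"
  define C where "C = norm F + 1"
  have t: "0 < t" "t < d" using d(1) by (auto simp: t_def)
  obtain f :: "nat \<Rightarrow> 'a \<Rightarrow>\<^sub>L real" and x :: "nat \<Rightarrow> 'a"
    where "\<And>k. norm (f k) \<le> 1" "\<And>m. norm (x m) \<le> norm F + 1"
      "\<And>k m. f k (x m) = (if k < m then t else 0)"
    using james_sequences[OF d(2) t] by blast
  then interpret james_system f x t C
    by unfold_locales (use t in \<open>auto simp: C_def\<close>)
  obtain c where c: "0 < c" "c \<le> 1" and half: "\<And>(x::'a) y A. 0 < A \<Longrightarrow> norm x \<le> A \<Longrightarrow> norm y \<le> A \<Longrightarrow>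
      norm ((1/2) *\<^sub>R (x + y)) \<le> (1 - c / 2) * A \<or> norm ((1/2) *\<^sub>R (y - x)) \<le> (1 - c / 2) * A"
    using uniformly_nonsquare_scaled[OF nsq] by blast
  \<comment> \<open>Three demands: \<open>e \<le> t / 2\<close> keeps every \<open>a n\<close> above
    \<open>t / 2\<close>; \<open>e < c * t / 4\<close> excludes a short half sum;
    \<open>e \<le> c * t / 8\<close> lets half of the gain \<open>c / 2\<close> absorb the error in
    the growth estimate.\<close>
  define e where "e = c * t / 24"
  have e: "0 < e" "e \<le> t / 24" using c t by (auto simp: e_def)
  \<comment> \<open>At this \<open>N\<close> the linear upper bound for \<open>N + 1\<close> blocks
    falls below the geometric lower bound; this decides how many sizes the Ramsey argument has to
    control.\<close>
  obtain N where N: "2 * C * (real N + 1) < t / 2 * (1 + c / 4) ^ N"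
    using power_dominates_linear[of "c / 4" "t / 2" "2 * C"] c(1) t(1) by auto
  obtain H where H: "infinite H" and ex: "\<And>n. n \<le> N + 1 \<Longrightarrow>
      \<exists>a. \<forall>P. P \<subseteq> H \<and> finite P \<and> card P = 2 * n \<longrightarrow> a \<le> gauge P \<and> gauge P < a + e"
    using nested_ramsey[of e gauge "\<lambda>n. 2 * real n * C" "N + 1"] e(1) gauge_bounds by auto
  obtain a where a: "\<And>n P. n \<le> N + 1 \<Longrightarrow> P \<subseteq> H \<Longrightarrow> finite P \<Longrightarrow> card P = 2 * n \<Longrightarrow>
      a n \<le> gauge P \<and> gauge P < a n + e"
    using ex by metis
  define h where "h = enumerate H"
  have h: "strict_mono h" using H by (simp add: h_def strict_mono_enumerate)
  have hA: "h ` A \<subseteq> H" "card (h ` A) = card A" for A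
    using enumerate_in_set[OF H] strict_mono_eq[OF h]
    by (auto simp: h_def intro!: card_image inj_onI)
  have low: "t / 2 \<le> a n" if "1 \<le> n" "n \<le> N + 1" for n
    using a[OF that(2) hA(1)[of "pattern_P n"]] gauge_ge_t[of "h ` pattern_P n" n]
      that(1) card_pattern(1) hA(2) e(2) t(1) by (simp add: card_pattern)
  have growth: "(1 + c / 4) * a n \<le> a (Suc n)" if n: "1 \<le> n" "n \<le> N" for n
  proof -
    have n1: "1 \<le> Suc n" and n2: "Suc n \<le> N + 1" and n3: "n \<le> N + 1" using n by auto
    note cards = card_pattern[OF n1]
    define A where "A = a (Suc n) + e"
    have A: "0 < A" using low[OF n1 n2] e(1) t(1) by (simp add: A_def)
    have P: "gauge (h ` pattern_P (Suc n)) < A" "gauge (h ` pattern_Q (Suc n)) < A"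
      using a[OF n2 hA(1)] cards hA(2) unfolding A_def by (metis finite_imageI finite_pattern(1,2))+
    have R: "a (Suc n) \<le> gauge (h ` pattern_R (Suc n))"
      using a[OF n2 hA(1)] cards hA(2) by (metis finite_imageI finite_pattern(3))
    have D: "a n \<le> gauge (h ` pattern_D (Suc n))"
      using a[OF n3 hA(1)] cards hA(2) by (metis finite_imageI finite_pattern(4) diff_Suc_1)
    have "\<exists>z\<in>blocks (h ` pattern_P (Suc n)). norm z < A" "\<exists>z\<in>blocks (h ` pattern_Q (Suc n)). norm z < A"
      using gauge_less[OF _ _ P(1), of "Suc n"] gauge_less[OF _ _ P(2), of "Suc n"] cards hA(2)
      by (metis finite_imageI finite_pattern(1,2))+
    then obtain z y where z: "z \<in> blocks (h ` pattern_P (Suc n))" "norm z < A"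
      and y: "y \<in> blocks (h ` pattern_Q (Suc n))" "norm y < A" by blast
    have R': "a (Suc n) \<le> norm ((1/2) *\<^sub>R (z + y))" and D': "a n \<le> norm ((1/2) *\<^sub>R (y - z))"
      using gauge_le[OF blocks_interlacing(1)[OF h n1 z(1) y(1)]] R
        gauge_le[OF blocks_interlacing(2)[OF h n1 z(1) y(1)]] D by linarith+
    \<comment> \<open>The half sum still has \<open>Suc n\<close> blocks, so its norm is at least
      \<open>A - e\<close>, too much for a drop by the factor \<open>1 - c / 2\<close>.
      Non-squareness must therefore shorten the half difference, which carries \<open>n\<close>
      blocks.\<close>
    consider "a (Suc n) \<le> (1 - c / 2) * A" | "a n \<le> (1 - c / 2) * A"
      using half[OF A less_imp_le[OF z(2)] less_imp_le[OF y(2)]] R' D' by linarith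
    then show ?thesis
    proof cases
      case 1
      then have "(c / 2) * A \<le> e" by (simp add: A_def algebra_simps)
      moreover have "(c / 2) * (t / 2) \<le> (c / 2) * A"
        using low[OF n1 n2] e(1) c(1) by (intro mult_left_mono) (simp_all add: A_def)
      moreover have "0 < c * t" using c(1) t(1) by simp
      ultimately have False unfolding e_def by linarith
      then show ?thesis ..
    next
      case 2
      have "(1 + c / 2) * a n \<le> (1 + c / 2) * ((1 - c / 2) * A)" using 2 c by (intro mult_left_mono) auto
      also have "\<dots> = (1 - (c / 2)\<^sup>2) * A" by (simp add: algebra_simps power2_eq_square)
      also have "\<dots> \<le> 1 * A" using A by (intro mult_right_mono) auto
      finally have "(1 + c / 2) * a n \<le> a (Suc n) + e" by (simp add: A_def)
      moreover have "(c / 4) * (t / 2) \<le> (c / 4) * a n"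
        using low[OF n(1) n3] c(1) by (intro mult_left_mono) auto
      moreover have "0 < c * t" using c(1) t(1) by simp
      ultimately show ?thesis by (simp add: e_def algebra_simps)
    qed
  qed
  have exp_growth: "t / 2 * (1 + c / 4) ^ n \<le> a (Suc n)" if "n \<le> N" for n
    using that
  proof (induction n)
    case 0
    then show ?case using low[of 1] by simp
  next
    case (Suc n)
    then have "(1 + c / 4) * (t / 2 * (1 + c / 4) ^ n) \<le> (1 + c / 4) * a (Suc n)"
      using c(1) by (intro mult_left_mono) auto
    also have "\<dots> \<le> a (Suc (Suc n))" using Suc.prems by (intro growth) auto
    finally show ?case by (simp add: mult.left_commute mult.assoc)
  qed
  have "a (Suc N) \<le> 2 * real (Suc N) * C"
    using a[of "Suc N" "h ` pattern_P (Suc N)"] hA card_pattern(1)[of "Suc N"]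
      gauge_bounds(2)[of "h ` pattern_P (Suc N)" "Suc N"] by simp
  with exp_growth[of N] N show False by (simp add: algebra_simps)
qed

section \<open>Points of smoothness in reflexive spaces\<close>

text \<open>In the main application the operations \<open>g n\<close> choose directions in which the
  norm is rough, so that the countable set contains the witnesses of its own roughness.\<close>

lemma countable_rational_hull:
  fixes S :: "'a::real_vector set" and g :: "nat \<Rightarrow> 'a \<Rightarrow> 'a"
  assumes "countable S"
  obtains Q where "countable Q" "S \<subseteq> Q" "\<And>x y. x \<in> Q \<Longrightarrow> y \<in> Q \<Longrightarrow> x + y \<in> Q"
    "\<And>r x. r \<in> \<rat> \<Longrightarrow> x \<in> Q \<Longrightarrow> r *\<^sub>R x \<in> Q" "\<And>n x. x \<in> Q \<Longrightarrow> g n x \<in> Q"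
proof -
  define step where "step A = A \<union> (\<lambda>(x, y). x + y) ` (A \<times> A) \<union> (\<lambda>(r, x). r *\<^sub>R x) ` (\<rat> \<times> A)
    \<union> (\<lambda>(n, x). g n x) ` (UNIV \<times> A)" for A
  define Qs where "Qs n = (step ^^ n) S" for n
  have Qs_Suc: "Qs (Suc n) = step (Qs n)" for n by (simp add: Qs_def)
  have count: "countable (Qs n)" for n
  proof (induction n)
    case (Suc n)
    then show ?case unfolding Qs_Suc step_def
      by (intro countable_Un countable_image countable_SIGMA countable_rat countableI_type)
  qed (simp add: Qs_def assms)
  have mono: "Qs m \<subseteq> Qs n" if "m \<le> n" for m n
    using that by (rule lift_Suc_mono_le[rotated]) (auto simp: Qs_Suc step_def)
  define Q where "Q = (\<Union>n. Qs n)"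
  have "countable Q" unfolding Q_def by (intro countable_UN count countableI_type)
  moreover have "x + y \<in> Q" if "x \<in> Q" "y \<in> Q" for x y
  proof -
    obtain m n where mn: "x \<in> Qs m" "y \<in> Qs n" using \<open>x \<in> Q\<close> \<open>y \<in> Q\<close> by (auto simp: Q_def)
    then have "x \<in> Qs (max m n)" "y \<in> Qs (max m n)"
      using mono[of m "max m n"] mono[of n "max m n"] by auto
    then have "x + y \<in> Qs (Suc (max m n))" unfolding Qs_Suc step_def by force
    then show ?thesis by (auto simp: Q_def)
  qed
  moreover have "r *\<^sub>R x \<in> Q" if "r \<in> \<rat>" "x \<in> Q" for r x
  proof -
    obtain m where "x \<in> Qs m" using \<open>x \<in> Q\<close> by (auto simp: Q_def)
    then have "r *\<^sub>R x \<in> Qs (Suc m)" using \<open>r \<in> \<rat>\<close> unfolding Qs_Suc step_def by force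
    then show ?thesis by (auto simp: Q_def)
  qed
  moreover have "g n x \<in> Q" if "x \<in> Q" for n x
  proof -
    obtain m where "x \<in> Qs m" using \<open>x \<in> Q\<close> by (auto simp: Q_def)
    then have "g n x \<in> Qs (Suc m)" unfolding Qs_Suc step_def by force
    then show ?thesis by (auto simp: Q_def)
  qed
  moreover have "S \<subseteq> Q" unfolding Q_def using Qs_def[of 0] by auto
  ultimately show ?thesis by (intro that[of Q])
qed

text \<open>For a fixed \<open>x\<close> in \<open>closure Q\<close>, the scalars that keep it there
  form a closed set containing the rationals, hence are all reals.\<close>

lemma subspace_closure_rational:
  fixes Q :: "'a::real_normed_vector set"
  assumes ne: "Q \<noteq> {}" and add: "\<And>x y. x \<in> Q \<Longrightarrow> y \<in> Q \<Longrightarrow> x + y \<in> Q"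
    and scale: "\<And>r x. r \<in> \<rat> \<Longrightarrow> x \<in> Q \<Longrightarrow> r *\<^sub>R x \<in> Q"
  shows "subspace (closure Q)"
  unfolding subspace_def
proof (intro conjI ballI allI)
  obtain q where "q \<in> Q" using ne by blast
  then have "0 *\<^sub>R q \<in> Q" by (intro scale) auto
  then show "0 \<in> closure Q" using closure_subset by auto
next
  fix x y assume "x \<in> closure Q" "y \<in> closure Q"
  then obtain X Y where "\<forall>n. X n \<in> Q" "X \<longlonglongrightarrow> x" "\<forall>n. Y n \<in> Q" "Y \<longlonglongrightarrow> y"
    unfolding closure_sequential by blast
  then show "x + y \<in> closure Q"
    unfolding closure_sequential using add by (intro exI[of _ "\<lambda>n. X n + Y n"]) (auto intro: tendsto_add)
next
  fix c :: real and x assume x: "x \<in> closure Q"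
  have "\<rat> \<subseteq> {c. c *\<^sub>R x \<in> closure Q}"
  proof (intro subsetI CollectI)
    fix r :: real assume r: "r \<in> \<rat>"
    obtain X where X: "\<forall>n. X n \<in> Q" "X \<longlonglongrightarrow> x" using x unfolding closure_sequential by blast
    then show "r *\<^sub>R x \<in> closure Q"
      unfolding closure_sequential using scale[OF r]
      by (intro exI[of _ "\<lambda>n. r *\<^sub>R X n"]) (auto intro: tendsto_intros)
  qed
  moreover have "closed ((\<lambda>c. c *\<^sub>R x) -` closure Q)"
    by (intro closed_vimage closed_closure continuous_intros)
  then have "closed {c. c *\<^sub>R x \<in> closure Q}" by (simp add: vimage_def)
  ultimately have "closure \<rat> \<subseteq> {c. c *\<^sub>R x \<in> closure Q}" by (rule closure_minimal)
  then show "c *\<^sub>R x \<in> closure Q" by (auto simp: Rats_closure_real)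
qed

lemma baire_cover:
  fixes Y :: "'a::complete_space set"
  assumes Y: "closed Y" "Y \<noteq> {}" and I: "countable I" and cover: "Y = (\<Union>i\<in>I. A i)"
  shows "\<exists>i\<in>I. \<exists>x\<in>Y. \<exists>r>0. ball x r \<inter> Y \<subseteq> closure (A i)"
proof (rule ccontr)
  assume contra: "\<not> ?thesis"
  have sub: "closure (A i) \<subseteq> Y" if "i \<in> I" for i
    using that cover Y(1) by (intro closure_minimal) auto
  have "completely_metrizable_space (top_of_set Y)"
    using Y(1) by (intro completely_metrizable_space_closedin completely_metrizable_space_euclidean) auto
  moreover have "closedin (top_of_set Y) (closure (A i)) \<and> top_of_set Y interior_of closure (A i) = {}"
    if i: "i \<in> I" for i
  proof
    show "closedin (top_of_set Y) (closure (A i))"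
      using sub[OF i] by (simp add: closed_subset)
    show "top_of_set Y interior_of closure (A i) = {}"
    proof (rule ccontr)
      assume "top_of_set Y interior_of closure (A i) \<noteq> {}"
      then obtain x T where T: "openin (top_of_set Y) T" "x \<in> T" "T \<subseteq> closure (A i)"
        by (auto simp: interior_of_def)
      then obtain r where "0 < r" "ball x r \<inter> Y \<subseteq> T" "x \<in> Y"
        unfolding openin_contains_ball by blast
      with T(3) contra i show False by blast
    qed
  qed
  ultimately have "top_of_set Y interior_of \<Union>((\<lambda>i. closure (A i)) ` I) = {}"
    using I by (intro Baire_category_alt) auto
  moreover have "\<Union>((\<lambda>i. closure (A i)) ` I) = Y"
    using sub cover closure_subset by blast
  ultimately show False using Y(2) interior_of_topspace[of "top_of_set Y"] by simp
qed

text \<open>A norm that is rough at every point is rough on a separable subspace \<open>Y\<close>. By reflexivity,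
  the support functionals at a countable dense subset of \<open>Y\<close> span a dense subset of the dual
  of \<open>Y\<close>, so countably many small balls cover it. By Baire, the support functionals at a dense
  subset of some open set all lie in one of these balls, which contradicts roughness there.\<close>

theorem reflexive_smooth_point:
  fixes v :: "'a::banach"
  assumes refl: "reflexive TYPE('a)" and v: "v \<noteq> 0" and e: "0 < e"
  shows "\<exists>x::'a. norm x = 1 \<and> (\<exists>d>0. \<forall>t y. 0 < t \<and> t < d \<and> norm y = 1 \<longrightarrow>
           norm (x + t *\<^sub>R y) + norm (x - t *\<^sub>R y) \<le> 2 + e * t)"
proof (rule ccontr)
  assume contra: "\<not> ?thesis"
  have rough1: "\<exists>t y. 0 < t \<and> t < d \<and> norm y = 1 \<and> 2 + e * t < norm (x + t *\<^sub>R y) + norm (x - t *\<^sub>R y)"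
    if "norm x = 1" "0 < d" for x :: 'a and d
    using contra that by (meson not_le)
  \<comment> \<open>Normalising \<open>q\<close> rescales \<open>t\<close> by the same factor, so by
    homogeneity the constant \<open>e\<close> is the same at all nonzero points.\<close>
  have rough: "\<exists>y t. 0 < t \<and> t < d \<and> norm y = 1 \<and>
      2 * norm q + e * t < norm (q + t *\<^sub>R y) + norm (q - t *\<^sub>R y)"
    if q: "q \<noteq> 0" "0 < d" for q :: 'a and d
  proof -
    define s where "s = norm q"
    have s: "0 < s" using q by (simp add: s_def)
    have "norm (q /\<^sub>R s) = 1" using s by (simp add: s_def)
    then obtain t y where ty: "0 < t" "t < d / s" "norm y = 1"
      "2 + e * t < norm (q /\<^sub>R s + t *\<^sub>R y) + norm (q /\<^sub>R s - t *\<^sub>R y)"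
      using rough1[of "q /\<^sub>R s" "d / s"] s q(2) by auto
    have eq: "norm (q + (s * t) *\<^sub>R y) = s * norm (q /\<^sub>R s + t *\<^sub>R y)"
      "norm (q - (s * t) *\<^sub>R y) = s * norm (q /\<^sub>R s - t *\<^sub>R y)"
    proof -
      have "q + (s * t) *\<^sub>R y = s *\<^sub>R (q /\<^sub>R s + t *\<^sub>R y)" "q - (s * t) *\<^sub>R y = s *\<^sub>R (q /\<^sub>R s - t *\<^sub>R y)"
        using s by (simp_all add: scaleR_add_right scaleR_diff_right)
      then show "norm (q + (s * t) *\<^sub>R y) = s * norm (q /\<^sub>R s + t *\<^sub>R y)"
        "norm (q - (s * t) *\<^sub>R y) = s * norm (q /\<^sub>R s - t *\<^sub>R y)"
        using s by (simp_all only: norm_scaleR abs_of_pos)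
    qed
    have "s * (2 + e * t) < s * (norm (q /\<^sub>R s + t *\<^sub>R y) + norm (q /\<^sub>R s - t *\<^sub>R y))"
      using ty(4) s by (rule mult_strict_left_mono)
    then have "2 * norm q + e * (s * t) < norm (q + (s * t) *\<^sub>R y) + norm (q - (s * t) *\<^sub>R y)"
      unfolding eq by (simp add: s_def algebra_simps)
    moreover have "0 < s * t" "s * t < d" using s ty by (simp_all add: field_simps)
    ultimately show ?thesis using ty(3) by blast
  qed
  \<comment> \<open>One direction per scale \<open>1 / (real n + 1)\<close>: roughness at
    arbitrarily small \<open>t\<close> is then witnessed by countably many directions.\<close>
  define w where "w n q = (SOME y. \<exists>t. 0 < t \<and> t < 1 / (real n + 1) \<and> norm y = 1 \<and>
      2 * norm q + e * t < norm (q + t *\<^sub>R y) + norm (q - t *\<^sub>R y))" for n and q :: 'a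
  have w: "\<exists>t. 0 < t \<and> t < 1 / (real n + 1) \<and> norm (w n q) = 1 \<and>
      2 * norm q + e * t < norm (q + t *\<^sub>R w n q) + norm (q - t *\<^sub>R w n q)" if "q \<noteq> 0" for n q
    unfolding w_def by (rule someI_ex[OF rough[OF that]]) simp
  obtain Q where Q: "countable Q" "{v} \<subseteq> Q" and Q_add: "\<And>x y. x \<in> Q \<Longrightarrow> y \<in> Q \<Longrightarrow> x + y \<in> Q"
    and Q_scale: "\<And>r x. r \<in> \<rat> \<Longrightarrow> x \<in> Q \<Longrightarrow> r *\<^sub>R x \<in> Q" and Q_w: "\<And>n x. x \<in> Q \<Longrightarrow> w n x \<in> Q"
    by (rule countable_rational_hull[OF countable_finite, of "{v}" w]) (simp, rule that)
  define Y where "Y = closure Q"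
  have Y: "subspace Y" "closed Y"
    unfolding Y_def using Q(2) by (intro subspace_closure_rational Q_add Q_scale closed_closure; blast)+
  have QY: "Q \<subseteq> Y" by (simp add: Y_def closure_subset)
  have "\<forall>q. \<exists>f :: 'a \<Rightarrow>\<^sub>L real. blinfun_apply f q = norm q \<and> norm f \<le> 1"
    by (rule allI, rule norming_functional) blast
  then obtain supp :: "'a \<Rightarrow> 'a \<Rightarrow>\<^sub>L real" where "\<forall>q. supp q q = norm q \<and> norm (supp q) \<le> 1"
    using choice[of "\<lambda>q (f :: 'a \<Rightarrow>\<^sub>L real). blinfun_apply f q = norm q \<and> norm f \<le> 1"] by blast
  then have supp: "supp q q = norm q" "norm (supp q) \<le> 1" for q by blast+
  have "countable (supp ` Q)" using Q(1) by simp
  then obtain M where M: "countable M" "supp ` Q \<subseteq> M" and M_add: "\<And>f g. f \<in> M \<Longrightarrow> g \<in> M \<Longrightarrow> f + g \<in> M"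
    and M_scale: "\<And>r f. r \<in> \<rat> \<Longrightarrow> f \<in> M \<Longrightarrow> r *\<^sub>R f \<in> M"
    by (rule countable_rational_hull[of "supp ` Q" "\<lambda>_ f. f"]) (rule that)
  \<comment> \<open>The dual of \<open>Y\<close> is the dual of \<open>X\<close> modulo the
    annihilator \<open>K\<close>. Sums \<open>m + k\<close> keep all functionals on
    \<open>X\<close>, the space known to be reflexive.\<close>
  define K where "K = {k :: 'a \<Rightarrow>\<^sub>L real. \<forall>y\<in>Y. k y = 0}"
  have K: "0 \<in> K" "\<And>k l. k \<in> K \<Longrightarrow> l \<in> K \<Longrightarrow> k + l \<in> K" "\<And>r k. k \<in> K \<Longrightarrow> r *\<^sub>R k \<in> K"
    by (auto simp: K_def blinfun.add_left blinfun.scaleR_left)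
  define MK where "MK = {m + k | m k. m \<in> M \<and> k \<in> K}"
  have M0: "0 \<in> M" using M_scale[of 0 "supp v"] M(2) Q(2) by auto
  have M_MK: "m \<in> MK" if "m \<in> M" for m
    unfolding MK_def using that K(1) by (intro CollectI exI[of _ m] exI[of _ 0]) simp
  have K_MK: "k \<in> MK" if "k \<in> K" for k
    unfolding MK_def using that M0 by (intro CollectI exI[of _ 0] exI[of _ k]) simp
  have MK: "subspace (closure MK)"
  proof (rule subspace_closure_rational)
    show "MK \<noteq> {}" using M_MK[OF M0] by blast
    show "f + g \<in> MK" if f: "f \<in> MK" and g: "g \<in> MK" for f g
    proof -
      obtain m k n l where "f = m + k" "g = n + l" "m \<in> M" "n \<in> M" "k \<in> K" "l \<in> K"
        using f g unfolding MK_def by blast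
      moreover from this have "f + g = (m + n) + (k + l)" by simp
      ultimately show ?thesis unfolding MK_def using M_add K(2) by blast
    qed
    show "r *\<^sub>R f \<in> MK" if r: "r \<in> \<rat>" and f: "f \<in> MK" for r f
    proof -
      obtain m k where "f = m + k" "m \<in> M" "k \<in> K" using f unfolding MK_def by blast
      moreover from this have "r *\<^sub>R f = r *\<^sub>R m + r *\<^sub>R k" by (simp add: scaleR_add_right)
      ultimately show ?thesis unfolding MK_def using M_scale[OF r] K(3) by blast
    qed
  qed
  \<comment> \<open>Otherwise some nonzero functional on the dual vanishes on \<open>MK\<close>; by
    reflexivity it is evaluation at some \<open>x \<noteq> 0\<close>. Vanishing on \<open>K\<close>
    puts \<open>x\<close> into \<open>Y\<close>, so some \<open>q\<close> in \<open>Q\<close> is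
    close to \<open>x\<close>. But \<open>supp q\<close> is 0 at \<open>x\<close> and
    \<open>norm q\<close> at \<open>q\<close>, so \<open>norm q \<le> norm (q - x)\<close>,
    impossible for \<open>q\<close> close to \<open>x\<close>.\<close>
  have full: "f \<in> closure MK" for f :: "'a \<Rightarrow>\<^sub>L real"
  proof (rule ccontr)
    assume f: "f \<notin> closure MK"
    obtain G :: "('a \<Rightarrow>\<^sub>L real) \<Rightarrow>\<^sub>L real" where G: "\<And>g. g \<in> closure MK \<Longrightarrow> G g = 0" "G f = infdist f (closure MK)"
      using distance_functional[OF MK, of f] by metis
    have "0 < infdist f (closure MK)"
      using f M_MK[OF M0] by (intro infdist_pos_not_in_closed) auto
    then have Gf: "G f \<noteq> 0" using G(2) by simp
    obtain x where x: "\<And>g. G g = blinfun_apply g x" using refl unfolding reflexive_def by blast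
    have zero: "g x = 0" if "g \<in> MK" for g
      using G(1)[of g] that closure_subset x[of g] by (metis subsetD)
    have "x \<in> Y"
    proof (rule ccontr)
      assume "x \<notin> Y"
      obtain g :: "'a \<Rightarrow>\<^sub>L real" where g: "\<And>y. y \<in> Y \<Longrightarrow> g y = 0" "g x = infdist x Y"
        using distance_functional[OF Y(1), of x] by metis
      have "0 < infdist x Y" using \<open>x \<notin> Y\<close> Y QY Q(2) by (intro infdist_pos_not_in_closed) auto
      moreover have "g \<in> K" using g(1) by (simp add: K_def)
      then have "g x = 0" by (intro zero K_MK)
      ultimately show False using g(2) by simp
    qed
    moreover have "x \<noteq> 0" using Gf x[of f] by auto
    ultimately obtain q where q: "q \<in> Q" "dist q x < norm x / 2"
      unfolding Y_def closure_approachable by (metis half_gt_zero zero_less_norm_iff)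
    have "supp q x = 0" using q(1) M(2) by (intro zero M_MK) auto
    then have "norm q = supp q (q - x)" using supp(1)[of q] by (simp add: blinfun.diff_right)
    also have "\<dots> \<le> norm (q - x)" by (rule blinfun_le_norm1(1)[OF supp(2)])
    finally have "norm q < norm x / 2" using q(2) by (simp add: dist_norm)
    moreover have "norm x \<le> norm q + norm (q - x)" by (metis norm_minus_commute norm_triangle_sub)
    ultimately show False using q(2) by (simp add: dist_norm)
  qed
  \<comment> \<open>Points with a support functional in the ball of radius \<open>e / 8\<close>
    about \<open>m\<close>, modulo \<open>K\<close>; two such functionals differ by less than
    \<open>e / 4\<close> at unit vectors of \<open>Y\<close>.\<close>
  define A where "A m = {x\<in>Y. \<exists>f. norm f \<le> 1 \<and> blinfun_apply f x = norm x \<and>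
      (\<exists>k\<in>K. norm (f - (m + k)) < e / 8)}"
    for m :: "'a \<Rightarrow>\<^sub>L real"
  have "Y = (\<Union>m\<in>M. A m)"
  proof
    show "Y \<subseteq> (\<Union>m\<in>M. A m)"
    proof
      fix x assume x: "x \<in> Y"
      have "0 < e / 8" using e by simp
      then obtain g where "g \<in> MK" "dist g (supp x) < e / 8"
        using full[of "supp x"] unfolding closure_approachable by blast
      moreover from this obtain m k where mk: "g = m + k" "m \<in> M" "k \<in> K"
        unfolding MK_def by blast
      ultimately have "norm (supp x - (m + k)) < e / 8" by (simp add: dist_norm norm_minus_commute)
      with mk(3) have "\<exists>k\<in>K. norm (supp x - (m + k)) < e / 8" by blast
      with x supp[of x] have "x \<in> A m" unfolding A_def by (intro CollectI conjI exI[of _ "supp x"])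
      with mk(2) show "x \<in> (\<Union>m\<in>M. A m)" by (rule UN_I)
    qed
    show "(\<Union>m\<in>M. A m) \<subseteq> Y" unfolding A_def by blast
  qed
  moreover have "Y \<noteq> {}" using QY Q(2) by blast
  ultimately have "\<exists>m\<in>M. \<exists>x\<in>Y. \<exists>r>0. ball x r \<inter> Y \<subseteq> closure (A m)"
    by (intro baire_cover Y(2) M(1))
  then obtain m x r where x: "x \<in> Y" and r: "0 < r" and sub: "ball x r \<inter> Y \<subseteq> closure (A m)"
    by blast
  \<comment> \<open>Roughness is available only at nonzero points, while the centre given by Baire's
    theorem may be 0.\<close>
  obtain x' where x': "x' \<in> Y" "x' \<noteq> 0" "dist x x' < r"
  proof (cases "x = 0")
    case True
    have "(r / (2 * norm v)) *\<^sub>R v \<in> Y" using QY Q(2) Y(1) by (auto intro: subspace_scale)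
    moreover have "dist x ((r / (2 * norm v)) *\<^sub>R v) < r" using True v r by (simp add: dist_norm)
    moreover have "(r / (2 * norm v)) *\<^sub>R v \<noteq> 0" using v r by simp
    ultimately show ?thesis using that by blast
  qed (use x r that in auto)
  then have "0 < min (norm x') (r - dist x x')" by simp
  then obtain q where q: "q \<in> Q" "dist q x' < min (norm x') (r - dist x x')"
    using x'(1) unfolding Y_def closure_approachable by blast
  have q0: "q \<noteq> 0" using q(2) by (auto simp: dist_norm)
  define s where "s = r - dist x q"
  have s: "0 < s" using q(2) dist_triangle[of x q x'] by (simp add: s_def dist_commute)
  obtain n where n: "1 / (real n + 1) < s"
    using reals_Archimedean[OF s] by (auto simp: inverse_eq_divide add.commute)
  define y where "y = w n q"
  obtain t where t: "0 < t" "t < s" "norm y = 1" "2 * norm q + e * t < norm (q + t *\<^sub>R y) + norm (q - t *\<^sub>R y)"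
    using w[OF q0, of n] n unfolding y_def by (meson less_trans)
  have yY: "y \<in> Y" using Q_w[OF q(1)] QY by (auto simp: y_def)
  have near: "q + c *\<^sub>R y \<in> closure (A m)" if "\<bar>c\<bar> = t" for c
  proof -
    have "q + c *\<^sub>R y \<in> Y" using q(1) QY yY Y(1) by (auto intro: subspace_add subspace_scale)
    moreover have "dist x (q + c *\<^sub>R y) < r"
      using dist_triangle[of x "q + c *\<^sub>R y" q] t(2,3) that by (simp add: dist_norm s_def)
    ultimately show ?thesis using sub by auto
  qed
  \<comment> \<open>Four errors \<open>\<eta>\<close> sum to \<open>e * t / 4\<close>, and the two
    support functionals contribute less than \<open>e * t / 4\<close>; together this stays below the
    roughness \<open>e * t\<close>.\<close>
  define \<eta> where "\<eta> = e * t / 16"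
  have \<eta>: "0 < \<eta>" using e t by (simp add: \<eta>_def)
  have support: "\<exists>f. (\<exists>k\<in>K. norm (f - (m + k)) < e / 8) \<and>
      norm (q + c *\<^sub>R y) - 2 * \<eta> - norm q \<le> c * blinfun_apply f y" if c: "\<bar>c\<bar> = t" for c
  proof -
    obtain a where a: "a \<in> A m" "dist a (q + c *\<^sub>R y) < \<eta>"
      using near[OF c] \<eta> unfolding closure_approachable by blast
    obtain f :: "'a \<Rightarrow>\<^sub>L real" where f: "norm f \<le> 1" "f a = norm a" "\<exists>k\<in>K. norm (f - (m + k)) < e / 8"
      using a(1) unfolding A_def by blast
    have "norm a - f (q + c *\<^sub>R y) = f (a - (q + c *\<^sub>R y))" by (simp add: f(2) blinfun.diff_right)
    also have "\<dots> \<le> norm (a - (q + c *\<^sub>R y))" by (rule blinfun_le_norm1(1)[OF f(1)])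
    finally have 1: "norm a - \<eta> \<le> f (q + c *\<^sub>R y)" using a(2) by (simp add: dist_norm)
    have 2: "norm (q + c *\<^sub>R y) - \<eta> \<le> norm a"
      using a(2) norm_triangle_sub[of "q + c *\<^sub>R y" a] by (simp add: dist_norm norm_minus_commute)
    have 3: "f q \<le> norm q" by (rule blinfun_le_norm1(1)[OF f(1)])
    have "f (q + c *\<^sub>R y) = f q + c * f y" by (simp add: blinfun.add_right blinfun.scaleR_right)
    with 1 2 3 f(3) show ?thesis by (intro exI[of _ f]) auto
  qed
  obtain f k :: "'a \<Rightarrow>\<^sub>L real" where f: "k \<in> K" "norm (f - (m + k)) < e / 8"
    "norm (q + t *\<^sub>R y) - 2 * \<eta> - norm q \<le> t * f y"
    using support[of t] t(1) by auto
  obtain g l :: "'a \<Rightarrow>\<^sub>L real" where g: "l \<in> K" "norm (g - (m + l)) < e / 8"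
    "norm (q - t *\<^sub>R y) - 2 * \<eta> - norm q \<le> - t * g y"
    using support[of "- t"] t(1) by auto
  have "f y - m y = (f - (m + k)) y" "m y - g y = - (g - (m + l)) y"
    using f(1) g(1) yY by (simp_all add: K_def blinfun.diff_left blinfun.add_left)
  then have "f y - m y < e / 8" "m y - g y < e / 8"
    using blinfun_le_norm(1)[of "f - (m + k)" y] blinfun_le_norm(1)[of "g - (m + l)" y] f(2) g(2) t(3) by auto
  then have "t * (f y - g y) < t * (e / 4)" using t(1) by (intro mult_strict_left_mono) auto
  then show False using f(3) g(3) t(4) \<eta> t(1) by (simp add: \<eta>_def algebra_simps)
qed

section \<open>Convex-transitive spaces\<close>

lemma blinfun_norm_approx:
  fixes f :: "'a::real_normed_vector \<Rightarrow>\<^sub>L real"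
  assumes "a < norm f"
  shows "\<exists>x. norm x \<le> 1 \<and> a < f x"
proof (rule ccontr)
  assume "\<not> ?thesis"
  then have le: "f x \<le> a" if "norm x \<le> 1" for x using that by force
  have "0 \<le> a" using le[of 0] by simp
  moreover have "norm (f x) \<le> a * norm x" for x
  proof (cases "x = 0")
    case False
    have "f (x /\<^sub>R norm x) \<le> a" "f (- (x /\<^sub>R norm x)) \<le> a" using False by (auto intro!: le)
    then have "\<bar>f x\<bar> / norm x \<le> a"
      using False by (simp add: blinfun.scaleR_right blinfun.minus_right divide_inverse_commute abs_if)
    then show ?thesis using False by (simp add: pos_divide_le_eq)
  qed simp
  ultimately have "norm f \<le> a" by (rule norm_blinfun_bound)
  with assms show False by simp
qed

text \<open>If \<open>f + g\<close> is nearly 2 at \<open>x\<close> and \<open>f - g\<close> nearly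
  2 at \<open>y\<close>, then \<open>f x\<close>, \<open>g x\<close>, \<open>f y\<close> and
  \<open>- g y\<close> are all nearly 1, so \<open>f\<close> shows that \<open>x + y\<close> is long
  and \<open>g\<close> that \<open>x - y\<close> is. Each of these uses two values that miss 1 by
  less than \<open>c / 2\<close>.\<close>

lemma uniformly_nonsquare_dual:
  assumes "uniformly_nonsquare TYPE('a::real_normed_vector)"
  shows "uniformly_nonsquare TYPE('a \<Rightarrow>\<^sub>L real)"
proof -
  obtain c where c: "0 < c" and nsq: "\<And>x y::'a. norm x \<le> 1 \<Longrightarrow> norm y \<le> 1 \<Longrightarrow>
      norm (x + y) \<le> 2 - c \<or> norm (x - y) \<le> 2 - c"
    using assms by (auto simp: uniformly_nonsquare_def)
  have "norm (f + g) \<le> 2 - c / 2 \<or> norm (f - g) \<le> 2 - c / 2"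
    if fg: "norm f \<le> 1" "norm g \<le> 1" for f g :: "'a \<Rightarrow>\<^sub>L real"
  proof (rule ccontr)
    assume "\<not> ?thesis"
    then have "2 - c / 2 < norm (f + g)" "2 - c / 2 < norm (f - g)" by auto
    then obtain x y where x: "norm x \<le> 1" "2 - c / 2 < (f + g) x" and y: "norm y \<le> 1" "2 - c / 2 < (f - g) y"
      using blinfun_norm_approx by metis
    note bounds = blinfun_le_norm1[OF fg(1), of x] blinfun_le_norm1[OF fg(2), of x]
      blinfun_le_norm1[OF fg(1), of y] blinfun_le_norm1[OF fg(2), of y]
    have "2 - c < f (x + y)" "2 - c < g (x - y)"
      using x y bounds
      by (auto simp: blinfun.add_left blinfun.diff_left blinfun.add_right blinfun.diff_right)
    then have "2 - c < norm (x + y)" "2 - c < norm (x - y)"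
      using blinfun_le_norm1(1)[OF fg(1), of "x + y"] blinfun_le_norm1(1)[OF fg(2), of "x - y"] by auto
    with nsq[OF x(1) y(1)] show False by simp
  qed
  then show ?thesis using c unfolding uniformly_nonsquare_def by (intro exI[of _ "c / 2"]) auto
qed

section \<open>Moving points into slices by isometries\<close>

lemma isometric_automorphismsD:
  assumes "T \<in> isometric_automorphisms"
  shows "linear T" "surj T" "norm (T x) = norm x"
  using assms by (auto simp: isometric_automorphisms_def)

text \<open>Used for two choices of \<open>S\<close>: a half-space, which shows that orbits meet
  every slice, and a sublevel set of the smoothness expression, which carries smoothness from an
  orbit to the sphere.\<close>

lemma convex_transitive_minimal:
  fixes S :: "'a::real_normed_vector set"
  assumes ct: "convex_transitive TYPE('a)" and x: "norm x = 1" and S: "convex S" "closed S"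
    and orbit: "\<And>T. T \<in> isometric_automorphisms \<Longrightarrow> T x \<in> S" and y: "norm y \<le> 1"
  shows "y \<in> S"
proof -
  have "convex hull (orbit x) \<subseteq> S"
    using orbit S(1) by (intro hull_minimal) (auto simp: orbit_def)
  then have "closure (convex hull (orbit x)) \<subseteq> S" using S(2) by (rule closure_minimal)
  then show ?thesis using ct x y by (auto simp: convex_transitive_def unit_sphere_def unit_ball_def)
qed

lemma convex_transitive_functional:
  fixes f :: "'a::real_normed_vector \<Rightarrow>\<^sub>L real"
  assumes ct: "convex_transitive TYPE('a)" and f: "norm f = 1" and x: "norm x = 1" and a: "a < 1"
  shows "\<exists>T\<in>isometric_automorphisms. a < f (T x)"
proof (rule ccontr)
  assume "\<not> ?thesis"
  then have orb: "T x \<in> {y. f y \<le> a}" if "T \<in> isometric_automorphisms" for T using that by force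
  have conv: "convex {y. f y \<le> a}"
    by (auto simp: convex_def blinfun.add_right blinfun.scaleR_right intro: convex_bound_le)
  have clos: "closed {y. f y \<le> a}"
    by (intro closed_Collect_le continuous_intros)
  have "y \<in> {y. f y \<le> a}" if "norm y \<le> 1" for y
    by (rule convex_transitive_minimal[OF ct x conv clos _ that]) (rule orb)
  with blinfun_norm_approx[of a f] a f show False by force
qed

text \<open>Moving the normalised midpoint deep into a slice moves both points along: their values
  under \<open>f\<close> are at most 1 and sum to more than \<open>2 - d\<close>. The bound
  \<open>d \<le> 1\<close> makes \<open>u + v\<close> nonzero.\<close>

lemma convex_transitive_midpoint:
  fixes f :: "'a::real_normed_vector \<Rightarrow>\<^sub>L real"
  assumes ct: "convex_transitive TYPE('a)" and f: "norm f = 1" and uv: "norm u \<le> 1" "norm v \<le> 1"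
    and d: "d \<le> 1" and mid: "2 - d < norm (u + v)"
  obtains T where "T \<in> isometric_automorphisms" "1 - d < f (T u)" "1 - d < f (T v)"
proof -
  define s where "s = norm (u + v)"
  have s: "0 < s" unfolding s_def using mid d by linarith
  have "norm ((u + v) /\<^sub>R s) = 1" using s by (simp add: s_def)
  moreover have "(2 - d) / s < 1" using mid s by (simp add: s_def)
  ultimately obtain T where T: "T \<in> isometric_automorphisms" "(2 - d) / s < f (T ((u + v) /\<^sub>R s))"
    using convex_transitive_functional[OF ct f] by blast
  note lin = isometric_automorphismsD[OF T(1)]
  have "f (T ((u + v) /\<^sub>R s)) = (f (T u) + f (T v)) / s"
    by (simp only: linear_scale[OF lin(1)] linear_add[OF lin(1)] blinfun.scaleR_right blinfun.add_right
        real_scaleR_def divide_inverse_commute)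
  then have "2 - d < f (T u) + f (T v)" using T(2) s by (simp add: divide_less_cancel)
  moreover have "f (T u) \<le> 1" "f (T v) \<le> 1"
    using blinfun_le_norm1(1)[of f "T u"] blinfun_le_norm1(1)[of f "T v"] f lin(3)[of u] lin(3)[of v] uv by auto
  ultimately show ?thesis using that[OF T(1)] by auto
qed

text \<open>If no slice of \<open>f\<close> lay in \<open>W\<close>, points outside \<open>W\<close>
  in slices of depth \<open>1 / (n + 1)\<close> would converge weakly to \<open>x\<close>, hence
  eventually enter the basic neighbourhood given by finitely many functionals.\<close>

lemma w_exposed_slice:
  fixes x :: "'a::real_normed_vector"
  assumes x: "w_exposed x" and W: "w_open_set W" "x \<in> W"
  obtains f :: "'a \<Rightarrow>\<^sub>L real" and d where "norm f = 1" "0 < d" "\<And>u. norm u \<le> 1 \<Longrightarrow> 1 - d < f u \<Longrightarrow> u \<in> W"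
proof -
  from x have "\<exists>f :: 'a \<Rightarrow> real. bounded_linear f \<and> onorm f = 1 \<and> f x = 1 \<and>
      (\<forall>s. (\<forall>n. norm (s n) \<le> 1) \<longrightarrow> (\<lambda>n. f (s n)) \<longlonglongrightarrow> 1 \<longrightarrow> weakly_converges s x)"
    unfolding w_exposed_def by (rule conjunct2)
  then obtain f :: "'a \<Rightarrow> real" where f: "bounded_linear f" "onorm f = 1"
    and exposed: "\<forall>s. (\<forall>n. norm (s n) \<le> 1) \<longrightarrow> (\<lambda>n. f (s n)) \<longlonglongrightarrow> 1 \<longrightarrow> weakly_converges s x"
    by (elim exE conjE) (rule that)
  have ap: "blinfun_apply (Blinfun f) = f" using f(1) by (rule bounded_linear_Blinfun_apply)
  have nf: "norm (Blinfun f) = 1" using f(2) by (simp add: norm_blinfun.rep_eq ap)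
  have f_le: "f u \<le> 1" if "norm u \<le> 1" for u
    using blinfun_le_norm1(1)[OF eq_refl[OF nf], of u] that unfolding ap by linarith
  have "\<exists>d>0. \<forall>u. norm u \<le> 1 \<longrightarrow> 1 - d < f u \<longrightarrow> u \<in> W"
  proof (rule ccontr)
    assume contra: "\<not> ?thesis"
    then have "\<exists>u. norm u \<le> 1 \<and> 1 - d < f u \<and> u \<notin> W" if "0 < d" for d using that by blast
    then have "\<forall>n. \<exists>u. norm u \<le> 1 \<and> 1 - inverse (real (Suc n)) < f u \<and> u \<notin> W" by simp
    from choice[OF this] obtain s
      where "\<forall>n. norm (s n) \<le> 1 \<and> 1 - inverse (real (Suc n)) < f (s n) \<and> s n \<notin> W" ..
    then have s: "norm (s n) \<le> 1" "1 - inverse (real (Suc n)) < f (s n)" "s n \<notin> W" for n by blast+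
    have "(\<lambda>n. f (s n)) \<longlonglongrightarrow> 1"
    proof (rule tendsto_sandwich)
      show "(\<lambda>n. 1 - inverse (real (Suc n))) \<longlonglongrightarrow> 1"
        using tendsto_diff[OF tendsto_const LIMSEQ_inverse_real_of_nat, of "1::real"] by simp
      show "\<forall>\<^sub>F n in sequentially. 1 - inverse (real (Suc n)) \<le> f (s n)"
        using s(2) by (intro always_eventually allI less_imp_le)
      show "\<forall>\<^sub>F n in sequentially. f (s n) \<le> 1"
        using s(1) by (intro always_eventually allI f_le)
    qed simp
    then have weak: "weakly_converges s x" using s(1) exposed by blast
    from bspec[OF W(1)[unfolded w_open_set_def] W(2)] obtain F :: "('a \<Rightarrow> real) set" and e :: real
      where F: "finite F" "\<forall>g\<in>F. bounded_linear g" "0 < e" "{y. \<forall>g\<in>F. \<bar>g y - g x\<bar> < e} \<subseteq> W"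
      by (elim exE conjE) (rule that)
    have "\<forall>g\<in>F. \<forall>\<^sub>F n in sequentially. \<bar>g (s n) - g x\<bar> < e"
    proof
      fix g assume "g \<in> F"
      with F(2) have "bounded_linear g" by (rule bspec)
      with weak have "(\<lambda>n. g (s n)) \<longlonglongrightarrow> g x" unfolding weakly_converges_def by simp
      then have "\<forall>\<^sub>F n in sequentially. dist (g (s n)) (g x) < e" using F(3) by (rule tendstoD)
      then show "\<forall>\<^sub>F n in sequentially. \<bar>g (s n) - g x\<bar> < e" by (simp add: dist_real_def)
    qed
    then have "\<forall>\<^sub>F n in sequentially. \<forall>g\<in>F. \<bar>g (s n) - g x\<bar> < e"
      using F(1) by (simp add: eventually_ball_finite_distrib)
    from eventually_happens'[OF sequentially_bot this]
    obtain n where "\<forall>g\<in>F. \<bar>g (s n) - g x\<bar> < e" ..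
    then have "s n \<in> W" by (intro subsetD[OF F(4)] CollectI)
    with s(3)[of n] show False by contradiction
  qed
  then obtain d where d: "0 < d" "\<forall>u. norm u \<le> 1 \<longrightarrow> 1 - d < f u \<longrightarrow> u \<in> W" by blast
  show ?thesis
  proof (rule that[OF nf d(1)])
    show "u \<in> W" if "norm u \<le> 1" "1 - d < blinfun_apply (Blinfun f) u" for u
      using that d(2) by (simp add: ap)
  qed
qed

text \<open>Points of the slice can be normalised without leaving it, which transfers the bound on the
  diameter from the sphere to the ball at the cost of \<open>2 * d\<close>.\<close>

lemma w_exposed_sphere_slice:
  fixes x :: "'a::real_normed_vector"
  assumes x: "w_exposed x" "x \<in> U" and U: "rel_weakly_open_sphere U" "diameter U < 2"
  obtains f :: "'a \<Rightarrow>\<^sub>L real" and d where "norm f = 1" "0 < d" "d \<le> 1"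
    "\<And>u v. norm u \<le> 1 \<Longrightarrow> norm v \<le> 1 \<Longrightarrow> 1 - d < f u \<Longrightarrow> 1 - d < f v \<Longrightarrow> norm (u - v) \<le> 2 - d"
proof -
  obtain W where W: "w_open_set W" "U = unit_sphere \<inter> W" using U(1) unfolding rel_weakly_open_sphere_def by blast
  then have xW: "x \<in> W" using x(2) by simp
  obtain f :: "'a \<Rightarrow>\<^sub>L real" and d0 where f: "norm f = 1" and d0: "0 < d0"
    and slice: "\<And>u. norm u \<le> 1 \<Longrightarrow> 1 - d0 < f u \<Longrightarrow> u \<in> W"
    by (rule w_exposed_slice[OF x(1) W(1) xW]) (rule that)
  \<comment> \<open>\<open>d0\<close> keeps normalised points in \<open>W\<close>;
    \<open>1/2\<close> makes \<open>f u\<close> positive, so that normalising can only increase it;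
    the last term gives \<open>diameter U + 2 * d \<le> 2 - d\<close>.\<close>
  define d where "d = min d0 (min (1/2) ((2 - diameter U) / 3))"
  have d: "0 < d" "d \<le> d0" "d \<le> 1/2" "3 * d \<le> 2 - diameter U"
  proof -
    have "d \<le> (2 - diameter U) / 3" unfolding d_def by (rule order_trans[OF min.cobounded2 min.cobounded2])
    then have "3 * d \<le> 3 * ((2 - diameter U) / 3)" by (rule mult_left_mono) simp
    then show "3 * d \<le> 2 - diameter U" by simp
  qed (use d0 U(2) in \<open>auto simp: d_def\<close>)
  have bdd: "bounded U"
    by (rule boundedI[of _ 1]) (use W(2) in \<open>auto simp: unit_sphere_def\<close>)
  have normalise: "u /\<^sub>R norm u \<in> U \<and> norm (u - u /\<^sub>R norm u) \<le> d" if u: "norm u \<le> 1" "1 - d < f u" for u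
  proof
    have fu: "f u \<le> norm u" using blinfun_le_norm1(1)[of f u] f by simp
    then have pos: "0 < norm u" "1 - d < norm u" using u d by linarith+
    have "1 * f u \<le> inverse (norm u) * f u"
      using u pos d by (intro mult_right_mono one_le_inverse) auto
    then have "f u \<le> f (u /\<^sub>R norm u)" by (simp add: blinfun.scaleR_right)
    then have "1 - d0 < f (u /\<^sub>R norm u)" using u(2) d(2) by linarith
    moreover have "norm (u /\<^sub>R norm u) = 1" using pos(1) by simp
    ultimately show "u /\<^sub>R norm u \<in> U"
      using slice[of "u /\<^sub>R norm u"] by (simp add: W(2) unit_sphere_def)
    have "u - u /\<^sub>R norm u = (1 - inverse (norm u)) *\<^sub>R u" by (simp add: scaleR_diff_left)
    then have "norm (u - u /\<^sub>R norm u) = \<bar>(1 - inverse (norm u)) * norm u\<bar>" by (simp add: abs_mult)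
    also have "(1 - inverse (norm u)) * norm u = norm u - 1" using pos(1) by (simp add: left_diff_distrib)
    finally have "norm (u - u /\<^sub>R norm u) = \<bar>norm u - 1\<bar>" .
    then show "norm (u - u /\<^sub>R norm u) \<le> d" using u(1) pos(2) by simp
  qed
  have "norm (u - v) \<le> 2 - d" if uv: "norm u \<le> 1" "norm v \<le> 1" "1 - d < f u" "1 - d < f v" for u v
  proof -
    define u' where "u' = u /\<^sub>R norm u"
    define v' where "v' = v /\<^sub>R norm v"
    have u': "u' \<in> U" "norm (u - u') \<le> d" using normalise[OF uv(1,3)] by (auto simp: u'_def)
    have v': "v' \<in> U" "norm (v - v') \<le> d" using normalise[OF uv(2,4)] by (auto simp: v'_def)
    have "u - v = (u - u') + (u' - v') - (v - v')" by simp
    then have "norm (u - v) = norm ((u - u') + (u' - v') - (v - v'))" by (rule arg_cong)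
    then have "norm (u - v) \<le> norm (u - u') + norm (u' - v') + norm (v - v')"
      using norm_triangle_ineq[of "u - u'" "u' - v'"]
        norm_triangle_ineq4[of "(u - u') + (u' - v')" "v - v'"] by linarith
    moreover have "norm (u' - v') \<le> diameter U"
      using diameter_bounded_bound[OF bdd u'(1) v'(1)] by (simp add: dist_norm)
    ultimately show ?thesis using u' v' d(4) by linarith
  qed
  moreover have "d \<le> 1" using d(3) by simp
  ultimately show ?thesis using that[OF f d(1)] by blast
qed

lemma convex_transitive_nonsquare:
  fixes f :: "'a::real_normed_vector \<Rightarrow>\<^sub>L real"
  assumes ct: "convex_transitive TYPE('a)" and f: "norm f = 1" and d: "0 < d" "d \<le> 1"
    and slice: "\<And>u v. norm u \<le> 1 \<Longrightarrow> norm v \<le> 1 \<Longrightarrow> 1 - d < f u \<Longrightarrow> 1 - d < f v \<Longrightarrow> norm (u - v) \<le> 2 - d"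
  shows "uniformly_nonsquare TYPE('a)"
proof -
  have "norm (u + v) \<le> 2 - d \<or> norm (u - v) \<le> 2 - d" if uv: "norm u \<le> 1" "norm v \<le> 1" for u v :: 'a
  proof (cases "2 - d < norm (u + v)")
    case True
    then obtain T where T: "T \<in> isometric_automorphisms" "1 - d < f (T u)" "1 - d < f (T v)"
      using convex_transitive_midpoint[OF ct f uv d(2)] by blast
    note iso = isometric_automorphismsD[OF T(1)]
    have "norm (T u - T v) \<le> 2 - d" using T uv iso(3) by (intro slice) auto
    then show ?thesis using iso(3)[of "u - v"] by (simp add: linear_diff[OF iso(1)])
  qed simp
  then show ?thesis using d(1) unfolding uniformly_nonsquare_def by blast
qed

section \<open>From one point of smoothness to uniform estimates\<close>

lemma convex_transitive_uniformly_smooth: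
  assumes ct: "convex_transitive TYPE('a::real_normed_vector)"
    and smooth: "\<And>e. 0 < e \<Longrightarrow> \<exists>x::'a. norm x = 1 \<and> (\<exists>d>0. \<forall>t y. 0 < t \<and> t < d \<and> norm y = 1 \<longrightarrow>
           norm (x + t *\<^sub>R y) + norm (x - t *\<^sub>R y) \<le> 2 + e * t)"
  shows "uniformly_smooth TYPE('a)"
  unfolding uniformly_smooth_def
proof (intro allI impI)
  fix e :: real assume e: "0 < e"
  obtain x :: 'a and d where x: "norm x = 1" and d: "0 < d"
    and smooth_x: "\<And>t y. 0 < t \<Longrightarrow> t < d \<Longrightarrow> norm y = 1 \<Longrightarrow> norm (x + t *\<^sub>R y) + norm (x - t *\<^sub>R y) \<le> 2 + e * t"
    using smooth[OF e] by blast
  have "(norm (z + t *\<^sub>R y) + norm (z - t *\<^sub>R y)) / 2 - 1 \<le> e * t"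
    if t: "0 < t" "t < d" and z: "norm z = 1" and y: "norm y = 1" for t and z y :: 'a
  proof -
    define S where "S = {z. norm (z + t *\<^sub>R y) + norm (z - t *\<^sub>R y) \<le> 2 + e * t}"
    have "z \<in> S"
    proof (rule convex_transitive_minimal[OF ct x])
      have comb: "norm ((\<alpha> *\<^sub>R a + \<beta> *\<^sub>R b) + c *\<^sub>R y) \<le> \<alpha> * norm (a + c *\<^sub>R y) + \<beta> * norm (b + c *\<^sub>R y)"
        if "0 \<le> \<alpha>" "0 \<le> \<beta>" "\<alpha> + \<beta> = 1" for \<alpha> \<beta> c :: real and a b
      proof -
        have "c *\<^sub>R y = (\<alpha> + \<beta>) *\<^sub>R (c *\<^sub>R y)" using that(3) by simp
        then have "(\<alpha> *\<^sub>R a + \<beta> *\<^sub>R b) + c *\<^sub>R y = \<alpha> *\<^sub>R (a + c *\<^sub>R y) + \<beta> *\<^sub>R (b + c *\<^sub>R y)"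
          unfolding scaleR_add_left scaleR_add_right by (simp only: ac_simps)
        then have "norm ((\<alpha> *\<^sub>R a + \<beta> *\<^sub>R b) + c *\<^sub>R y) \<le> norm (\<alpha> *\<^sub>R (a + c *\<^sub>R y)) + norm (\<beta> *\<^sub>R (b + c *\<^sub>R y))"
          using norm_triangle_ineq by metis
        then show ?thesis using that(1,2) by simp
      qed
      show "convex S"
        unfolding convex_def
      proof (intro ballI allI impI)
        fix a b and \<alpha> \<beta> :: real assume ab: "a \<in> S" "b \<in> S" "0 \<le> \<alpha>" "0 \<le> \<beta>" "\<alpha> + \<beta> = 1"
        define q where "q w = norm (w + t *\<^sub>R y) + norm (w - t *\<^sub>R y)" for w
        have "q (\<alpha> *\<^sub>R a + \<beta> *\<^sub>R b) \<le> \<alpha> * q a + \<beta> * q b"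
          using comb[OF ab(3-5), of a b t] comb[OF ab(3-5), of a b "- t"]
          by (simp add: q_def algebra_simps)
        also have "\<dots> \<le> 2 + e * t"
          using ab by (intro convex_bound_le) (simp_all add: S_def q_def)
        finally show "\<alpha> *\<^sub>R a + \<beta> *\<^sub>R b \<in> S" by (simp add: S_def q_def)
      qed
      show "closed S" unfolding S_def by (intro closed_Collect_le continuous_intros)
      show "T x \<in> S" if T: "T \<in> isometric_automorphisms" for T
      proof -
        note iso = isometric_automorphismsD[OF T]
        \<comment> \<open>At the orbit point \<open>T x\<close> the direction \<open>y\<close>
          corresponds to the direction \<open>w\<close> at \<open>x\<close>; hence smoothness at
          \<open>x\<close> has to be uniform over all unit directions.\<close>
        obtain w where w: "y = T w" using iso(2) by (metis surjD)
        have "norm w = 1" using iso(3)[of w] y w by simp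
        then have "norm (T (x + t *\<^sub>R w)) + norm (T (x - t *\<^sub>R w)) \<le> 2 + e * t"
          using smooth_x[OF t] by (simp add: iso(3))
        then show ?thesis
          by (simp add: S_def w linear_add[OF iso(1)] linear_diff[OF iso(1)] linear_scale[OF iso(1)])
      qed
      show "norm z \<le> 1" using z by simp
    qed
    then have "norm (z + t *\<^sub>R y) + norm (z - t *\<^sub>R y) \<le> 2 + e * t" by (simp add: S_def)
    also have "\<dots> \<le> 2 + 2 * (e * t)" using e t by simp
    finally show ?thesis by (simp add: field_simps)
  qed
  with d show "\<exists>d>0. \<forall>t. 0 < t \<and> t < d \<longrightarrow> (\<forall>x y :: 'a. norm x = 1 \<longrightarrow> norm y = 1 \<longrightarrow>
      (norm (x + t *\<^sub>R y) + norm (x - t *\<^sub>R y)) / 2 - 1 \<le> e * t)" by blast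
qed

text \<open>The easy half of Smulian's theorem: smoothness of the dual norm at \<open>f\<close> makes the slices
  of the unit ball defined by \<open>f\<close> small.\<close>

lemma small_slices:
  fixes f :: "'a::real_normed_vector \<Rightarrow>\<^sub>L real"
  assumes t: "0 < t" and smooth: "\<And>g :: 'a \<Rightarrow>\<^sub>L real. norm g = 1 \<Longrightarrow> norm (f + t *\<^sub>R g) + norm (f - t *\<^sub>R g) \<le> 2 + e * t"
    and e: "0 < e" and uv: "norm u \<le> 1" "norm v \<le> 1" and f: "1 - e * t < f u" "1 - e * t < f v"
  shows "norm (u - v) \<le> 3 * e"
proof (cases "u = v")
  case False
  then obtain g :: "'a \<Rightarrow>\<^sub>L real" where g: "g (u - v) = norm (u - v)" "norm g = 1"
    using norming_functional_unit[of "u - v"] by auto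
  \<comment> \<open>The two values sum to \<open>f u + f v + t * norm (u - v)\<close>. Smoothness
    allows an excess of \<open>e * t\<close> over 2 and the slice conditions lose at most
    \<open>2 * e * t\<close>, whence the factor 3.\<close>
  have "(f + t *\<^sub>R g) u \<le> norm (f + t *\<^sub>R g) * norm u" "(f - t *\<^sub>R g) v \<le> norm (f - t *\<^sub>R g) * norm v"
    by (rule blinfun_le_norm)+
  moreover have "norm (f + t *\<^sub>R g) * norm u \<le> norm (f + t *\<^sub>R g) * 1"
    "norm (f - t *\<^sub>R g) * norm v \<le> norm (f - t *\<^sub>R g) * 1"
    using uv by (intro mult_left_mono; simp)+
  ultimately have "(f + t *\<^sub>R g) u + (f - t *\<^sub>R g) v \<le> 2 + e * t"
    using smooth[OF g(2)] by linarith
  moreover have "(f + t *\<^sub>R g) u + (f - t *\<^sub>R g) v = f u + f v + t * norm (u - v)"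
    unfolding g(1)[symmetric]
    by (simp add: blinfun.add_left blinfun.diff_left blinfun.scaleR_left blinfun.diff_right algebra_simps)
  ultimately have "t * norm (u - v) \<le> t * (3 * e)" using f by (simp add: algebra_simps)
  then show ?thesis using t by simp
qed (use e in simp)

lemma convex_transitive_uniformly_convex:
  assumes ct: "convex_transitive TYPE('a::real_normed_vector)"
    and smooth: "\<And>e. 0 < e \<Longrightarrow> \<exists>f::'a \<Rightarrow>\<^sub>L real. norm f = 1 \<and> (\<exists>d>0. \<forall>t g. 0 < t \<and> t < d \<and> norm g = 1 \<longrightarrow>
           norm (f + t *\<^sub>R g) + norm (f - t *\<^sub>R g) \<le> 2 + e * t)"
  shows "uniformly_convex TYPE('a)"
  unfolding uniformly_convex_def
proof (intro allI impI)
  fix e :: real assume e: "0 < e"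
  \<comment> \<open>With \<open>e / 4\<close> in the smoothness estimate the slices have diameter at
    most \<open>3 * (e / 4)\<close>, strictly below \<open>e\<close>.\<close>
  then have e4: "0 < e / 4" by simp
  obtain f :: "'a \<Rightarrow>\<^sub>L real" and d where f: "norm f = 1" and d: "0 < d"
    and smooth_f: "\<And>t g. 0 < t \<Longrightarrow> t < d \<Longrightarrow> norm g = 1 \<Longrightarrow> norm (f + t *\<^sub>R g) + norm (f - t *\<^sub>R g) \<le> 2 + e / 4 * t"
    using smooth[OF e4] by blast
  define t where "t = d / 2"
  have t: "0 < t" "t < d" using d by (auto simp: t_def)
  define c where "c = min 1 (e / 4 * t)"
  have c: "0 < c" "c \<le> 1" "c \<le> e / 4 * t" using e t by (auto simp: c_def)
  have "norm ((x + y) /\<^sub>R 2) \<le> 1 - c / 2" if xy: "norm x \<le> 1" "norm y \<le> 1" "e \<le> norm (x - y)" for x y :: 'a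
  proof (rule ccontr)
    assume "\<not> ?thesis"
    then have "2 - c < norm (x + y)" by simp
    then obtain T where T: "T \<in> isometric_automorphisms" "1 - c < f (T x)" "1 - c < f (T y)"
      using convex_transitive_midpoint[OF ct f xy(1,2) c(2)] by blast
    note iso = isometric_automorphismsD[OF T(1)]
    have "norm (T x - T y) \<le> 3 * (e / 4)"
      using T c(3) xy iso(3) by (intro small_slices[OF t(1) smooth_f[OF t] e4]) auto
    then have "norm (x - y) \<le> 3 * (e / 4)" using iso(3)[of "x - y"] by (simp add: linear_diff[OF iso(1)])
    with xy(3) e show False by simp
  qed
  then show "\<exists>\<delta>>0. \<forall>x y::'a. norm x \<le> 1 \<longrightarrow> norm y \<le> 1 \<longrightarrow> e \<le> norm (x - y)
      \<longrightarrow> norm ((x + y) /\<^sub>R 2) \<le> 1 - \<delta>"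
    using c(1) by (intro exI[of _ "c / 2"]) auto
qed

lemma uniformly_convex_almost_transitive:
  assumes ct: "convex_transitive TYPE('a::real_normed_vector)" and uc: "uniformly_convex TYPE('a)"
  shows "almost_transitive TYPE('a)"
  unfolding almost_transitive_def
proof (intro allI impI equalityI)
  fix x :: 'a assume "x \<in> unit_sphere"
  then have x: "norm x = 1" by (simp add: unit_sphere_def)
  have "closed (unit_sphere :: 'a set)"
    unfolding unit_sphere_def by (intro closed_Collect_eq continuous_intros)
  then show "closure (orbit x) \<subseteq> unit_sphere"
    using x by (intro closure_minimal) (auto simp: orbit_def unit_sphere_def isometric_automorphisms_def)
  show "unit_sphere \<subseteq> closure (orbit x)"
  proof
    fix y :: 'a assume "y \<in> unit_sphere"
    then have y: "norm y = 1" by (simp add: unit_sphere_def)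
    have "\<exists>z\<in>orbit x. dist z y < e" if e: "0 < e" for e
    proof -
      obtain d where d: "0 < d" and conv: "\<And>u v :: 'a. norm u \<le> 1 \<Longrightarrow> norm v \<le> 1 \<Longrightarrow> e \<le> norm (u - v)
          \<Longrightarrow> norm ((u + v) /\<^sub>R 2) \<le> 1 - d"
        using uc e unfolding uniformly_convex_def by blast
      have "y \<noteq> 0" using y by auto
      then obtain f :: "'a \<Rightarrow>\<^sub>L real" where f: "f y = norm y" "norm f = 1" by (rule norming_functional_unit)
      \<comment> \<open>The depth \<open>2 * d\<close> is halved at the midpoint: \<open>f\<close>
        is 1 at \<open>y\<close>, so the midpoint of \<open>T x\<close> and \<open>y\<close> has
        norm above \<open>1 - d\<close>.\<close>
      have "1 - 2 * d < 1" using d by simp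
      then obtain T where T: "T \<in> isometric_automorphisms" "1 - 2 * d < f (T x)"
        using convex_transitive_functional[OF ct f(2) x] by blast
      have "2 - 2 * d < f (T x + y)" using T(2) f(1) y by (simp add: blinfun.add_right)
      also have "\<dots> \<le> norm (T x + y)" using f(2) by (intro blinfun_le_norm1) simp
      finally have "1 - d < norm ((T x + y) /\<^sub>R 2)" by simp
      moreover have "norm ((T x + y) /\<^sub>R 2) \<le> 1 - d" if "e \<le> norm (T x - y)"
        using isometric_automorphismsD(3)[OF T(1), of x] x y that by (intro conv) auto
      ultimately have "norm (T x - y) < e" by linarith
      then show ?thesis using T(1) by (auto simp: orbit_def dist_norm)
    qed
    then show "y \<in> closure (orbit x)" by (simp add: closure_approachable)
  qed
qed

theorem theorem2:
  assumes ct: "convex_transitive TYPE('a::banach)"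
    and dense: "\<forall>U::'a set. rel_weakly_open_sphere U \<and> U \<noteq> {} \<longrightarrow>
                   (\<exists>x\<in>U. w_exposed x)"
    and diam: "Inf {diameter U | U::'a set. rel_weakly_open_sphere U \<and> U \<noteq> {}} < 2"
  shows "almost_transitive TYPE('a) \<and> uniformly_convex TYPE('a) \<and> uniformly_smooth TYPE('a)"
proof (cases "\<exists>v::'a. v \<noteq> 0")
  \<comment> \<open>In the zero space the sphere is empty and all three properties hold
    vacuously.\<close>
  case False
  then have "x = 0" for x :: 'a by blast
  then have no_unit: "norm x \<noteq> 1" "\<not> e \<le> norm x" if "0 < e" for x :: 'a and e
    using that by (metis norm_zero zero_neq_one, metis norm_zero not_le)
  show ?thesis
    unfolding almost_transitive_def uniformly_convex_def uniformly_smooth_def unit_sphere_def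
    using no_unit zero_less_one by blast
next
  case True
  then obtain v :: 'a where v: "v \<noteq> 0" by blast
  let ?D = "{diameter U | U::'a set. rel_weakly_open_sphere U \<and> U \<noteq> {}}"
  \<comment> \<open>The whole sphere is admissible, so the infimum is over a nonempty set and its
    being below 2 yields an actual \<open>U\<close>.\<close>
  have "w_open_set (UNIV :: 'a set)"
    unfolding w_open_set_def by (intro ballI exI[of _ "{}"] exI[of _ 1]) simp
  then have "rel_weakly_open_sphere (unit_sphere :: 'a set)"
    unfolding rel_weakly_open_sphere_def by (intro exI[of _ UNIV]) simp
  moreover have "v /\<^sub>R norm v \<in> unit_sphere" using v by (simp add: unit_sphere_def)
  ultimately have "diameter (unit_sphere :: 'a set) \<in> ?D" by blast
  then have "?D \<noteq> {}" by blast
  from cInf_lessD[OF this diam] obtain U :: "'a set"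
    where U: "rel_weakly_open_sphere U" "U \<noteq> {}" "diameter U < 2" by blast
  then obtain x where x: "x \<in> U" "w_exposed x" using dense by blast
  have nsq: "uniformly_nonsquare TYPE('a)"
    by (rule w_exposed_sphere_slice[OF x(2,1) U(1,3)]) (rule convex_transitive_nonsquare[OF ct])
  obtain f :: "'a \<Rightarrow>\<^sub>L real" where "norm f = 1" using norming_functional_unit[OF v] by blast
  then have f: "f \<noteq> 0" by auto
  have "uniformly_smooth TYPE('a)"
    using uniformly_nonsquare_imp_reflexive[OF nsq] v
    by (intro convex_transitive_uniformly_smooth[OF ct] reflexive_smooth_point)
  \<comment> \<open>Here the dual takes the place of the space: its own non-squareness makes it
    reflexive, and the nearly smooth points of its norm are functionals on \<open>X\<close>.\<close>
  moreover have "uniformly_convex TYPE('a)"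
    using uniformly_nonsquare_imp_reflexive[OF uniformly_nonsquare_dual[OF nsq]] f
    by (intro convex_transitive_uniformly_convex[OF ct] reflexive_smooth_point)
  ultimately show ?thesis using uniformly_convex_almost_transitive[OF ct] by blast
qed

end
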